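(* Let $p$ be an odd prime, $m\in\mathbb{N}$ and $q=p^m$ with $q\ge 5$, $q\ne 9$, and assume $4\mid\frac{q-1}{p-1}$. Put $n=\frac{q-1}{4}$. Then the generalized Paley sum graph $\Gamma^+(4,q)$ is connected and all its eigenvalues are integers; more precisely: (a) If $p\equiv1\pmod 4$, then $m=4t$ for some $t\in\mathbb{N}$, and for integers $c,d$ with $\sqrt q=c^2+4d^2$, $c\equiv 1\pmod 4$, $\gcd(c,p)=1$ ($c$ unique, $d$ unique up to sign), the eigenvalues of $\Gamma^+(4,q)$, listed with multiplicity, are: $n$ once, and each of $$\pm\tfrac{\sqrt q+4d\sqrt[4]{q}-1}{4},\quad \pm\tfrac{\sqrt q-4d\sqrt[4]{q}-1}{4},\quad \pm\tfrac{-\sqrt q+2c\sqrt[4]{q}-1}{4},\quad \pm\tfrac{-\sqrt q-2c\sqrt[4]{q}-1}{4}$$ (all eight values) with multiplicity $\frac n2$. (b) If $p\equiv 3\pmod 4$, then $m=2t$ for some $t\in\mathbb{N}$, and the eigenvalues of $\Gamma^+(4,q)$, listed with multiplicity, are: if $m\equiv 0\pmod 4$, $n$ once, each of $\pm\frac{\sqrt q-1}{4}$ with multiplicity $\frac{3n}{2}$ and each of $\pm\frac{3\sqrt q+1}{4}$ with multiplicity $\frac n2$; if $m\equiv 2\pmod 4$, $n$ once, each of $\pm\frac{\sqrt q+1}{4}$ with multiplicity $\frac{3n}{2}$ and each of $\pm\frac{3\sqrt q-1}{4}$ with multiplicity $\frac n2$.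
   Context: For a prime power $q$ and $k\mid q-1$, let $R_k=\{x^k: x\in\mathbb{F}_q^*\}$. The generalized Paley sum graph $\Gamma^+(k,q)$ is the Cayley sum graph on vertex set $\mathbb{F}_q$: its adjacency matrix $A$ is indexed by $\mathbb{F}_q$ with $A_{v,w}=1$ if $v+w\in R_k$ and $0$ otherwise (loops allowed). Its eigenvalues are those of $A$. "$\pm x$ with multiplicity $e$" means both $x$ and $-x$ occur, each with multiplicity $e$. *)

theory Defs
  imports
    "HOL-Analysis.Analysis"
    "HOL-Computational_Algebra.Computational_Algebra"
    "HOL-Number_Theory.Cong"
    "Graph_Theory.Graph_Theory"
begin

text \<open>A finite field with \<open>q\<close> elements is a type \<open>'a\<close> of class \<open>{field, finite}\<close>
  with \<open>CARD('a) = q\<close>.\<close>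

definition kth_powers :: "nat \<Rightarrow> 'a::field set" where
  "kth_powers k = {x ^ k | x. x \<noteq> 0}"

text \<open>The arc relation is symmetric, so each undirected edge is represented by both of its
  orientations; a loop at \<open>v\<close> is present when \<open>v + v\<close> is a nonzero \<open>k\<close>-th power.\<close>

definition paley_sum_graph :: "nat \<Rightarrow> 'a::field pair_pre_digraph" where
  "paley_sum_graph k = \<lparr>pverts = UNIV, parcs = {(v, w). v + w \<in> kth_powers k}\<rparr>"

definition adjacency_matrix :: "'a::finite pair_pre_digraph \<Rightarrow> complex ^ 'a ^ 'a" where
  "adjacency_matrix G = (\<chi> v w. if (v, w) \<in> parcs G then 1 else 0)"

definition charpoly :: "'b::comm_ring_1 ^ 'n::finite ^ 'n \<Rightarrow> 'b poly" where
  "charpoly A = det (mat [:0, 1:] - (\<chi> i j. [:A $ i $ j:]))"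

text \<open>The eigenvalues over the complex numbers, with algebraic multiplicity; when the arc relation
  is symmetric, the matrix is real symmetric and this agrees with the geometric multiplicity.\<close>

definition graph_spectrum :: "'a::finite pair_pre_digraph \<Rightarrow> complex multiset" where
  "graph_spectrum G = proots (charpoly (adjacency_matrix G))"

definition pm_mset :: "nat \<Rightarrow> real \<Rightarrow> real multiset" where
  "pm_mset e x = replicate_mset e x + replicate_mset e (- x)"

definition quartic_pair :: "nat \<Rightarrow> nat \<Rightarrow> int \<Rightarrow> int \<Rightarrow> bool" where
  "quartic_pair p q c d \<longleftrightarrow>
     sqrt (real q) = of_int (c\<^sup>2 + 4 * d\<^sup>2) \<and> [c = 1] (mod 4) \<and> coprime c (int p)"

end

theory Submission
imports Defs
begin

text \<open>
  The eigenvalues are the degree \<open>n\<close> and \<open>\<plusminus> \<eta>\<close>, where \<open>\<eta>\<close> runs through the four quartic Gauss periods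
  of an additive character \<open>\<psi>\<close>. With the Gauss sums \<open>X + \<i> Y\<close> of a quartic character \<open>\<rho>\<close> and \<open>g = \<plusminus> \<surd>q\<close> of
  \<open>\<rho>\<^sup>2\<close>, the periods are \<open>(- 1 + g \<plusminus> 2 X) / 4\<close> and \<open>(- 1 - g \<plusminus> 2 Y) / 4\<close>. They are integers because
  \<open>p - 1\<close> divides \<open>n\<close>; this yields congruences modulo 4. Moreover \<open>X\<^sup>2 + Y\<^sup>2 = q\<close> and \<open>(X + \<i> Y)\<^sup>2 = g J\<close>, where
  \<open>J\<close> is the Jacobi sum of \<open>\<rho>\<close> with itself.
  If \<open>p \<equiv> 3 (mod 4)\<close>, the Frobenius automorphism shows that \<open>J\<close> is real, so \<open>X Y = 0\<close>. If \<open>p \<equiv> 1 (mod 4)\<close>,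
  then \<open>J\<close> is not divisible by \<open>p\<close>, because it reduces to the binomial coefficient \<open>- (3 n choose n)\<close>
  modulo a prime above \<open>p\<close>. Hence \<open>p\<^sup>t\<close> exactly divides \<open>X + \<i> Y\<close>, where \<open>q = p\<^sup>4\<^sup>t\<close>, and the quotient
  provides \<open>c\<close> and \<open>d\<close>. Neither the sign of \<open>g\<close> nor the theorem of Hasse and Davenport is needed.
\<close>

section \<open>Finite fields and additive characters\<close>

text \<open>Translation by 1 permutes the ring, so adding 1 to every element leaves the sum of all
  elements unchanged.\<close>

lemma CHAR_dvd_CARD: "CHAR('a::{ring_1,finite}) dvd CARD('a)"
proof -
  have "(\<Sum>x\<in>UNIV. x) = (\<Sum>x\<in>UNIV. x + (1::'a))"
    by (rule sum.reindex_bij_witness[of _ "\<lambda>x. x + 1" "\<lambda>x. x - 1"]) auto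
  then have "of_nat CARD('a) = (0::'a)" by (simp add: sum.distrib)
  then show ?thesis by (simp add: of_nat_eq_0_iff_char_dvd)
qed

lemma CHAR_eq_of_CARD_eq_prime_power:
  assumes "CARD('a::{field,finite}) = p ^ m" "prime p"
  shows "CHAR('a) = p"
proof -
  have "CHAR('a) > 0" by (rule finite_imp_CHAR_pos) simp
  then have "prime CHAR('a)" by (rule prime_CHAR_semidom)
  moreover have "CHAR('a) dvd p ^ m" using CHAR_dvd_CARD[where 'a='a] assms by simp
  ultimately show ?thesis
    by (metis assms(2) prime_dvd_power primes_dvd_imp_eq)
qed

text \<open>Multiplication by \<open>x\<close> permutes the nonzero elements; compare their product
  before and after.\<close>

lemma power_CARD_minus_1:
  fixes x :: "'a::{field,finite}"
  assumes "x \<noteq> 0"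
  shows "x ^ (CARD('a) - 1) = 1"
proof -
  have "(\<Prod>y\<in>UNIV-{0}. x * y) = (\<Prod>y\<in>UNIV-{0}. y)"
    by (rule prod.reindex_bij_witness[of _ "\<lambda>y. y / x" "\<lambda>y. x * y"]) (use assms in auto)
  moreover have "(\<Prod>y\<in>UNIV-{0}. x * y) = x ^ (CARD('a) - 1) * \<Prod>(UNIV-{0})"
    by (simp add: prod.distrib)
  moreover have "\<Prod>(UNIV-{0::'a}) \<noteq> 0" by simp
  ultimately show ?thesis by simp
qed

lemma power_CARD:
  fixes x :: "'a::{field,finite}"
  shows "x ^ CARD('a) = x"
proof (cases "x = 0")
  case False
  have "x ^ CARD('a) = x * x ^ (CARD('a) - 1)"
    by (subst power_Suc[symmetric]) simp
  then show ?thesis using power_CARD_minus_1[OF False] by simp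
qed simp

lemma card_power_eq_le:
  fixes c :: "'a::idom"
  assumes "k > 0"
  shows "card {x. x ^ k = c} \<le> k"
proof -
  let ?p = "monom 1 k - [:c:]"
  have "degree (monom (1::'a) k + - [:c:]) = degree (monom (1::'a) k)"
    by (rule degree_add_eq_left) (use assms in \<open>simp add: degree_monom_eq\<close>)
  then have d: "degree ?p = k" by (simp only: diff_conv_add_uminus degree_monom_eq[OF one_neq_zero])
  then have "?p \<noteq> 0" using assms by auto
  then have "card {x. poly ?p x = 0} \<le> k" using card_poly_roots_bound d by metis
  then show ?thesis by (simp add: poly_monom)
qed

text \<open>Replacing \<open>x\<close> by \<open>g * x\<close> multiplies the sum by
  \<open>g ^ k\<close>, so one nonzero \<open>g\<close> with \<open>g ^ k \<noteq> 1\<close> makes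
  it vanish. This evaluates the Jacobi sum in the field itself.\<close>

lemma sum_power_finite_field:
  assumes "k > 0"
  shows "(\<Sum>x\<in>UNIV. (x::'a::{field,finite}) ^ k) = (if (CARD('a) - 1) dvd k then - 1 else 0)"
proof (cases "(CARD('a) - 1) dvd k")
  case True
  then obtain l where l: "k = (CARD('a) - 1) * l" by auto
  have "(\<Sum>x\<in>UNIV. (x::'a) ^ k) = (\<Sum>x\<in>UNIV - {0::'a}. x ^ k)"
    using assms by (intro sum.mono_neutral_right) auto
  also have "\<dots> = (\<Sum>x\<in>UNIV - {0::'a}. 1)"
    by (intro sum.cong refl) (metis DiffD2 insertCI l power_CARD_minus_1 power_mult power_one)
  also have "\<dots> = of_nat (CARD('a)) - 1"
    using zero_less_card_finite[where 'a='a] by (simp add: of_nat_diff Suc_leI)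
  also have "\<dots> = - 1"
    using CHAR_dvd_CARD[where 'a='a] by (simp add: of_nat_eq_0_iff_char_dvd)
  finally show ?thesis using True by simp
next
  case False
  \<comment> \<open>Only the residue of \<open>k\<close> matters, and \<open>x ^ r = 1\<close> has
    at most \<open>r\<close> solutions, fewer than the nonzero elements; any other nonzero element
    serves as \<open>g\<close>.\<close>
  define r where "r = k mod (CARD('a) - 1)"
  have r: "0 < r" using False by (simp add: r_def mod_greater_zero_iff_not_dvd)
  have gt1: "CARD('a) > 1" using card_mono[of UNIV "{0,1::'a}"] by simp
  then have "r < CARD('a) - 1" by (simp add: r_def)
  then have "card {x::'a. x ^ r = 1} < card (UNIV - {0::'a})"
    using card_power_eq_le[OF r, of "1::'a"] by simp
  then have "\<not> UNIV - {0} \<subseteq> {x::'a. x ^ r = 1}"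
    using card_mono[of "{x::'a. x ^ r = 1}"] by (metis finite leD)
  then obtain g :: 'a where g: "g \<noteq> 0" "g ^ r \<noteq> 1" by auto
  have "k = (CARD('a) - 1) * (k div (CARD('a) - 1)) + r" by (simp add: r_def)
  then have "g ^ k = (g ^ (CARD('a) - 1)) ^ (k div (CARD('a) - 1)) * g ^ r"
    by (metis power_add power_mult)
  then have "g ^ k = g ^ r" using power_CARD_minus_1[OF g(1)] by simp
  then have gk: "g ^ k \<noteq> 1" using g by simp
  have "(\<Sum>x\<in>UNIV. (x::'a) ^ k) = (\<Sum>x\<in>UNIV. (g * x) ^ k)"
    by (rule sum.reindex_bij_witness[of _ "\<lambda>y. g * y" "\<lambda>y. y / g"]) (use g in auto)
  also have "\<dots> = g ^ k * (\<Sum>x\<in>UNIV. x ^ k)"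
    by (simp add: power_mult_distrib sum_distrib_left)
  finally have "(\<Sum>x\<in>UNIV. (x::'a) ^ k) = 0" using gk by simp
  then show ?thesis using False by simp
qed

section \<open>Additive characters and their orthogonality\<close>

locale additive_character =
  fixes \<psi> :: "'a::{field,finite} \<Rightarrow> complex"
  assumes add: "\<psi> (x + y) = \<psi> x * \<psi> y"
    and zero [simp]: "\<psi> 0 = 1"
    and nontrivial: "\<exists>x. \<psi> x \<noteq> 1"
begin

lemma of_nat_mult: "\<psi> (of_nat k * x) = \<psi> x ^ k"
  by (induction k) (auto simp: add distrib_right)

text \<open>Since \<open>CARD('a)\<close> annihilates the field, \<open>\<psi> x\<close> is a root
  of unity, and the inverse of a number of norm 1 is its conjugate.\<close>

lemma uminus: "\<psi> (- x) = cnj (\<psi> x)"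
proof -
  have "of_nat (CARD('a)) = (0::'a)"
    using CHAR_dvd_CARD[where 'a='a] by (simp add: of_nat_eq_0_iff_char_dvd)
  then have "\<psi> x ^ CARD('a) = 1" using of_nat_mult[of "CARD('a)" x] by simp
  then have "norm (\<psi> x) ^ CARD('a) = 1" by (metis norm_power norm_one)
  then have "norm (\<psi> x) = 1"
    using power_eq_1_iff[of "norm (\<psi> x)" "CARD('a)"] by auto
  then have "\<psi> x * cnj (\<psi> x) = 1" by (simp add: complex_norm_square[symmetric])
  moreover have "\<psi> x * \<psi> (- x) = 1" using add[of x "-x"] by simp
  ultimately show ?thesis by (metis mult_cancel_left mult_zero_left zero_neq_one)
qed

lemma sum_eq: "(\<Sum>x\<in>UNIV. \<psi> (a * x)) = (if a = 0 then of_nat CARD('a) else 0)"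
proof (cases "a = 0")
  case False
  obtain z where z: "\<psi> z \<noteq> 1" using nontrivial by blast
  have "(\<Sum>x\<in>UNIV. \<psi> (a * x)) = (\<Sum>x\<in>UNIV. \<psi> x)"
    by (rule sum.reindex_bij_witness[of _ "\<lambda>y. y / a" "\<lambda>y. a * y"]) (use False in auto)
  moreover have "(\<Sum>x\<in>UNIV. \<psi> x) = 0"
  proof -
    have "(\<Sum>x\<in>UNIV. \<psi> x) = (\<Sum>x\<in>UNIV. \<psi> (z + x))"
      by (rule sum.reindex_bij_witness[of _ "\<lambda>y. z + y" "\<lambda>y. y - z"]) auto
    also have "\<dots> = \<psi> z * (\<Sum>x\<in>UNIV. \<psi> x)" by (simp add: add sum_distrib_left)
    finally show ?thesis using z by simp
  qed
  ultimately show ?thesis using False by simp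
qed simp

end

text \<open>The prime field is the fixed field of Frobenius: its \<open>p\<close> elements are fixed
  by additivity of the \<open>p\<close>-th power, and the fixed points are roots of a polynomial of
  degree \<open>p\<close>.\<close>

lemma of_nat_image_roots:
  assumes "CHAR('a::{field,finite}) = p" "prime p"
  shows "inj_on (of_nat :: nat \<Rightarrow> 'a) {..<p}"
    and "(of_nat :: nat \<Rightarrow> 'a) ` {..<p} = {x. x ^ p = x}"
proof -
  show inj: "inj_on (of_nat :: nat \<Rightarrow> 'a) {..<p}"
    using assms by (auto simp: inj_on_def of_nat_eq_iff_cong_CHAR cong_def)
  have p0: "p > 1" using assms prime_gt_1_nat by auto
  have "(of_nat k :: 'a) ^ p = of_nat k" for k
  proof (induction k)
    case (Suc k)
    have "(1 + of_nat k :: 'a) ^ p = 1 ^ p + of_nat k ^ p"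
      by (rule freshmans_dream) (use assms in auto)
    then show ?case using Suc by simp
  qed (use p0 in simp)
  then have sub: "(of_nat :: nat \<Rightarrow> 'a) ` {..<p} \<subseteq> {x. x ^ p = x}" by blast
  have "{x::'a. x ^ p = x} \<subseteq> insert 0 {x. x ^ (p - 1) = 1}"
  proof
    fix x :: 'a assume "x \<in> {x. x ^ p = x}"
    moreover have "x ^ p = x * x ^ (p - 1)" using p0 by (subst power_Suc[symmetric]) simp
    ultimately show "x \<in> insert 0 {x. x ^ (p - 1) = 1}" by simp
  qed
  then have "card {x::'a. x ^ p = x} \<le> card (insert 0 {x::'a. x ^ (p - 1) = 1})"
    by (intro card_mono) auto
  also have "\<dots> \<le> Suc (card {x::'a. x ^ (p - 1) = 1})" by (rule card_insert_le_m1) auto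
  also have "\<dots> \<le> p" using card_power_eq_le[of "p - 1" "1::'a"] p0 by simp
  finally have "card {x::'a. x ^ p = x} \<le> p" .
  moreover have "card ((of_nat :: nat \<Rightarrow> 'a) ` {..<p}) = p" using inj by (simp add: card_image)
  ultimately show "(of_nat :: nat \<Rightarrow> 'a) ` {..<p} = {x. x ^ p = x}"
    using sub by (intro card_seteq) auto
qed

text \<open>Compose the absolute trace to the prime field with the powers of a primitive
  \<open>p\<close>-th root of unity.\<close>

lemma additive_character_exists:
  assumes card: "CARD('a::{field,finite}) = p ^ m" and p: "prime p"
  shows "\<exists>\<psi>::'a \<Rightarrow> complex. additive_character \<psi>"
proof -
  have ch: "CHAR('a) = p" using assms by (rule CHAR_eq_of_CARD_eq_prime_power)
  have p1: "p > 1" using p prime_gt_1_nat by auto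
  have m0: "m > 0" using card card_mono[of UNIV "{0,1::'a}"] by (cases m) auto
  \<comment> \<open>\<open>T\<close> is the absolute trace. Frobenius shifts its summands
    cyclically, so its values lie in the prime field.\<close>
  define T where "T x = (\<Sum>j<m. x ^ (p ^ j))" for x :: 'a
  have T_add: "T (x + y) = T x + T y" for x y
    unfolding T_def sum.distrib[symmetric]
    by (intro sum.cong refl, rule freshmans_dream') (use ch p in auto)
  have T_pow: "T x ^ p = T x" for x
  proof -
    have "T x ^ p = (\<Sum>j<m. (x ^ (p ^ j)) ^ p)"
      unfolding T_def by (rule freshmans_dream_sum) (use ch p in auto)
    also have "\<dots> = (\<Sum>j<m. x ^ (p ^ Suc j))"
      by (simp add: power_mult[symmetric] mult.commute)
    also have "\<dots> = T x + x ^ (p ^ m) - x"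
      using sum.lessThan_Suc_shift[of "\<lambda>j. x ^ (p ^ j)" m]
      unfolding T_def sum.lessThan_Suc by (simp add: algebra_simps del: power_Suc)
    also have "\<dots> = T x" using power_CARD[of x] card by simp
    finally show ?thesis .
  qed
  \<comment> \<open>As a nonzero polynomial of degree at most \<open>p ^ (m - 1)\<close>, the trace
    cannot vanish on all \<open>p ^ m\<close> elements.\<close>
  obtain x0 where x0: "T x0 \<noteq> 0"
  proof -
    let ?P = "\<Sum>j<m. monom (1::'a) (p ^ j)"
    have co: "coeff ?P (p ^ (m - 1)) = 1"
    proof -
      have "coeff ?P (p ^ (m - 1)) = (\<Sum>j<m. if j = m - 1 then 1 else 0)"
        unfolding coeff_sum using p1 by (intro sum.cong) (auto simp: coeff_monom)
      then show ?thesis using m0 by simp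
    qed
    then have "?P \<noteq> 0" by (metis coeff_0 zero_neq_one)
    moreover have "degree ?P \<le> p ^ (m - 1)"
      by (intro degree_sum_le) (use p1 in \<open>auto intro: order.trans[OF degree_monom_le] power_increasing\<close>)
    ultimately have "card {x. poly ?P x = 0} \<le> p ^ (m - 1)"
      using card_poly_roots_bound le_trans by blast
    also have "\<dots> < p ^ m" using p1 m0 by (intro power_strict_increasing) auto
    finally have "{x. poly ?P x = 0} \<noteq> UNIV" using card by auto
    then have "\<exists>x. poly ?P x \<noteq> 0" by blast
    then show ?thesis using that by (auto simp: poly_sum poly_monom T_def)
  qed
  define k where "k x = (THE j. j < p \<and> of_nat j = T x)" for x
  have k: "k x < p \<and> of_nat (k x) = T x" for x
  proof -
    have "T x \<in> of_nat ` {..<p}" using of_nat_image_roots(2)[OF ch p] T_pow by blast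
    moreover have "inj_on (of_nat :: nat \<Rightarrow> 'a) {..<p}" by (rule of_nat_image_roots(1)[OF ch p])
    ultimately have "\<exists>!j. j < p \<and> of_nat j = T x" by (auto simp: inj_on_def)
    then show ?thesis unfolding k_def by (rule theI')
  qed
  define \<zeta> where "\<zeta> = cis (2 * pi / of_nat p)"
  have "\<zeta> ^ p = cis (real p * (2 * pi / real p))" by (simp only: \<zeta>_def Complex.DeMoivre of_nat_id)
  also have "real p * (2 * pi / real p) = 2 * pi" using p1 by simp
  finally have z: "\<zeta> ^ p = 1" by simp
  have z_mod: "\<zeta> ^ (j mod p) = \<zeta> ^ j" for j
  proof -
    have "\<zeta> ^ j = \<zeta> ^ (p * (j div p) + j mod p)" by simp
    also have "\<dots> = \<zeta> ^ (j mod p)" unfolding power_add power_mult z by simp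
    finally show ?thesis by simp
  qed
  have z_ne: "\<zeta> ^ j \<noteq> 1" if "0 < j" "j < p" for j
  proof
    assume "\<zeta> ^ j = 1"
    then have "cis (2 * pi * real j / real p) = cis (2 * pi * real 0 / real p)"
      by (simp add: \<zeta>_def Complex.DeMoivre mult.commute mult.left_commute)
    then have "j = 0"
      using Complex.bij_betw_roots_unity[of p] p1 that
      by (intro inj_onD[of "\<lambda>k. cis (2 * pi * real k / real p)" "{..<p}" j 0])
         (auto simp: bij_betw_def)
    then show False using that by simp
  qed
  have "additive_character (\<lambda>x. \<zeta> ^ k x)"
  proof
    fix x y
    have "of_nat (k (x + y)) = (of_nat (k x + k y) :: 'a)" using k T_add by simp
    then have "k (x + y) mod p = (k x + k y) mod p"
      using ch by (simp add: of_nat_eq_iff_cong_CHAR cong_def del: of_nat_add)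
    then show "\<zeta> ^ k (x + y) = \<zeta> ^ k x * \<zeta> ^ k y"
      using z_mod[of "k (x + y)"] z_mod[of "k x + k y"] by (simp add: power_add)
  next
    have "T 0 = 0" using p1 by (simp add: T_def power_0_left)
    then have "of_nat (k 0) = (0::'a)" using k by simp
    then have "p dvd k 0" using ch by (simp add: of_nat_eq_0_iff_char_dvd)
    then have "k 0 = 0" using k[of 0] nat_dvd_not_less by blast
    then show "\<zeta> ^ k 0 = 1" by simp
  next
    have "k x0 \<noteq> 0" using k[of x0] x0 by (metis of_nat_0)
    then show "\<exists>x. \<zeta> ^ k x \<noteq> 1" using z_ne k by blast
  qed
  then show ?thesis by blast
qed

section \<open>Gauss and Jacobi sums\<close>

locale multiplicative_character =
  fixes \<rho> :: "'a::{field,finite} \<Rightarrow> complex"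
  assumes chi_zero [simp]: "\<rho> 0 = 0"
    and chi_one [simp]: "\<rho> 1 = 1"
    and chi_mult: "\<rho> (x * y) = \<rho> x * \<rho> y"
begin

lemma chi_power: "\<rho> (x ^ k) = \<rho> x ^ k"
  by (induction k) (auto simp: chi_mult)

lemma chi_mult_cnj: "x \<noteq> 0 \<Longrightarrow> \<rho> x * cnj (\<rho> x) = 1"
proof -
  assume "x \<noteq> 0"
  then have "\<rho> x ^ (CARD('a) - 1) = 1" using power_CARD_minus_1[of x] chi_power[of x] chi_one by metis
  moreover have "CARD('a) > 1" using card_mono[of UNIV "{0,1::'a}"] by simp
  ultimately have "norm (\<rho> x) = 1" using power_eq_1_iff[of "\<rho> x" "CARD('a) - 1"] by simp
  then show ?thesis by (simp add: complex_norm_square[symmetric])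
qed

lemma cnj_chi: "cnj (\<rho> x) = \<rho> (inverse x)"
proof (cases "x = 0")
  case False
  have "\<rho> x * \<rho> (inverse x) = 1" using False by (simp add: chi_mult[symmetric])
  then show ?thesis using chi_mult_cnj[OF False] by (metis mult_cancel_left mult_zero_left zero_neq_one)
qed simp

lemma sum_chi_eq_0:
  assumes "z \<noteq> 0" "\<rho> z \<noteq> 1"
  shows "(\<Sum>x\<in>UNIV. \<rho> x) = 0"
proof -
  have "(\<Sum>x\<in>UNIV. \<rho> x) = (\<Sum>x\<in>UNIV. \<rho> (z * x))"
    by (rule sum.reindex_bij_witness[of _ "\<lambda>y. z * y" "\<lambda>y. y / z"]) (use assms in auto)
  also have "\<dots> = \<rho> z * (\<Sum>x\<in>UNIV. \<rho> x)" by (simp add: chi_mult sum_distrib_left)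
  finally show ?thesis using assms by simp
qed

end

definition gauss_sum :: "('a::{field,finite} \<Rightarrow> complex) \<Rightarrow> ('a \<Rightarrow> complex) \<Rightarrow> complex" where
  "gauss_sum \<rho> \<psi> = (\<Sum>x\<in>UNIV. \<rho> x * \<psi> x)"

definition jacobi_sum :: "('a::{field,finite} \<Rightarrow> complex) \<Rightarrow> ('a \<Rightarrow> complex) \<Rightarrow> complex" where
  "jacobi_sum \<rho> \<eta> = (\<Sum>x\<in>UNIV. \<rho> x * \<eta> (1 - x))"

lemma gauss_sum_twist:
  assumes "multiplicative_character \<rho>" "a \<noteq> 0"
  shows "(\<Sum>x\<in>UNIV. \<rho> x * \<psi> (a * x)) = cnj (\<rho> a) * gauss_sum \<rho> \<psi>"
proof -
  interpret multiplicative_character \<rho> by fact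
  have "(\<Sum>x\<in>UNIV. \<rho> x * \<psi> (a * x)) = (\<Sum>x\<in>UNIV. \<rho> (inverse a * x) * \<psi> x)"
    by (rule sum.reindex_bij_witness[of _ "\<lambda>y. inverse a * y" "\<lambda>y. a * y"])
       (use assms in \<open>auto simp: mult.assoc[symmetric]\<close>)
  then show ?thesis by (simp add: chi_mult cnj_chi gauss_sum_def sum_distrib_left mult.assoc)
qed

text \<open>Parseval: the squared norms of the sums \<open>g a\<close> are added over all
  \<open>a\<close> in two ways. Orthogonality of \<open>\<psi>\<close> gives
  \<open>(q - 1) * q\<close> with \<open>q = CARD('a)\<close>; twisting shows that each nonzero
  \<open>a\<close> contributes the squared norm of the Gauss sum, while \<open>g 0\<close>
  vanishes.\<close>

lemma gauss_sum_norm: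
  fixes \<rho> \<psi> :: "'a::{field,finite} \<Rightarrow> complex"
  assumes "multiplicative_character \<rho>" "additive_character \<psi>" and z: "z \<noteq> 0" "\<rho> z \<noteq> 1"
  shows "gauss_sum \<rho> \<psi> * cnj (gauss_sum \<rho> \<psi>) = of_nat CARD('a)"
proof -
  interpret multiplicative_character \<rho> by fact
  interpret additive_character \<psi> by fact
  define g where "g a = (\<Sum>x\<in>UNIV. \<rho> x * \<psi> (a * x))" for a
  let ?G = "gauss_sum \<rho> \<psi>"
  have "(\<Sum>a\<in>UNIV. g a * cnj (g a)) = (\<Sum>a\<in>UNIV. \<Sum>x\<in>UNIV. \<Sum>y\<in>UNIV. \<rho> x * cnj (\<rho> y) * \<psi> ((x - y) * a))"
    unfolding g_def cnj_sum sum_product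
    by (intro sum.cong refl)
       (simp add: uminus[symmetric] add[symmetric] algebra_simps flip: add)
  also have "\<dots> = (\<Sum>x\<in>UNIV. \<Sum>a\<in>UNIV. \<Sum>y\<in>UNIV. \<rho> x * cnj (\<rho> y) * \<psi> ((x - y) * a))"
    by (rule sum.swap)
  also have "\<dots> = (\<Sum>x\<in>UNIV. \<Sum>y\<in>UNIV. \<rho> x * cnj (\<rho> y) * (\<Sum>a\<in>UNIV. \<psi> ((x - y) * a)))"
    by (subst sum.swap) (simp add: sum_distrib_left)
  also have "\<dots> = (\<Sum>x\<in>UNIV. \<rho> x * cnj (\<rho> x) * of_nat CARD('a))"
    by (intro sum.cong refl) (simp add: sum_eq if_distrib cong: if_cong)
  also have "\<dots> = (\<Sum>x\<in>UNIV - {0}. \<rho> x * cnj (\<rho> x) * of_nat CARD('a))"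
    by (intro sum.mono_neutral_right) auto
  also have "\<dots> = (\<Sum>x\<in>UNIV - {0::'a}. of_nat CARD('a))"
    by (intro sum.cong refl) (simp add: chi_mult_cnj)
  finally have 1: "(\<Sum>a\<in>UNIV. g a * cnj (g a)) = of_nat (card (UNIV - {0::'a})) * of_nat CARD('a)" by simp
  have "g 0 = 0" unfolding g_def using sum_chi_eq_0[OF z] by simp
  then have "(\<Sum>a\<in>UNIV. g a * cnj (g a)) = (\<Sum>a\<in>UNIV - {0}. g a * cnj (g a))"
    by (intro sum.mono_neutral_right) auto
  also have "\<dots> = (\<Sum>a\<in>UNIV - {0::'a}. ?G * cnj ?G)"
  proof (intro sum.cong refl)
    fix a :: 'a assume "a \<in> UNIV - {0}"
    then have a: "a \<noteq> 0" by simp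
    then have "g a = cnj (\<rho> a) * ?G" unfolding g_def by (intro gauss_sum_twist assms)
    then have "g a * cnj (g a) = (\<rho> a * cnj (\<rho> a)) * (?G * cnj ?G)" by (simp add: mult_ac)
    then show "g a * cnj (g a) = ?G * cnj ?G" using chi_mult_cnj[OF a] by simp
  qed
  finally have "of_nat (card (UNIV - {0::'a})) * (?G * cnj ?G) = of_nat (card (UNIV - {0::'a})) * of_nat CARD('a)"
    using 1 by (simp only: sum_constant)
  moreover have "card (UNIV - {0::'a}) \<noteq> 0"
    using z by (metis DiffI UNIV_I card_0_eq empty_iff finite insertE)
  ultimately show ?thesis by (metis mult_cancel_left of_nat_eq_0_iff)
qed

text \<open>Expand the product and collect the terms with \<open>x + y = s\<close>. Scaling by
  \<open>s\<close> turns the inner sum into a Jacobi sum; for \<open>s = 0\<close> it vanishes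
  because the product character is nontrivial.\<close>

lemma gauss_sum_mult:
  fixes \<rho> \<eta> \<psi> :: "'a::{field,finite} \<Rightarrow> complex"
  assumes "multiplicative_character \<rho>" "multiplicative_character \<eta>" "additive_character \<psi>"
    and nontriv: "(\<Sum>x\<in>UNIV. \<rho> x * \<eta> x) = 0"
  shows "gauss_sum \<rho> \<psi> * gauss_sum \<eta> \<psi> = jacobi_sum \<rho> \<eta> * gauss_sum (\<lambda>x. \<rho> x * \<eta> x) \<psi>"
proof -
  interpret C: multiplicative_character \<rho> by fact
  interpret E: multiplicative_character \<eta> by fact
  interpret additive_character \<psi> by fact
  have inner: "(\<Sum>x\<in>UNIV. \<rho> x * \<eta> (s - x)) = \<rho> s * \<eta> s * jacobi_sum \<rho> \<eta>" for s
  proof (cases "s = 0")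
    case True
    have "\<rho> x * \<eta> (- x) = \<eta> (- 1) * (\<rho> x * \<eta> x)" for x
      using E.chi_mult[of "-1" x] by simp
    then have "(\<Sum>x\<in>UNIV. \<rho> x * \<eta> (- x)) = \<eta> (- 1) * (\<Sum>x\<in>UNIV. \<rho> x * \<eta> x)"
      by (simp only: sum_distrib_left)
    then show ?thesis using True nontriv by simp
  next
    case False
    have "(\<Sum>x\<in>UNIV. \<rho> x * \<eta> (s - x)) = (\<Sum>x\<in>UNIV. \<rho> (s * x) * \<eta> (s * (1 - x)))"
      by (rule sum.reindex_bij_witness[of _ "\<lambda>y. s * y" "\<lambda>y. y / s"])
         (use False in \<open>auto simp: algebra_simps\<close>)
    then show ?thesis by (simp add: C.chi_mult E.chi_mult jacobi_sum_def sum_distrib_left mult_ac)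
  qed
  have "gauss_sum \<rho> \<psi> * gauss_sum \<eta> \<psi> = (\<Sum>x\<in>UNIV. \<Sum>y\<in>UNIV. \<rho> x * \<eta> y * \<psi> (x + y))"
    unfolding gauss_sum_def sum_product by (intro sum.cong refl) (simp add: add mult_ac)
  also have "\<dots> = (\<Sum>x\<in>UNIV. \<Sum>s\<in>UNIV. \<rho> x * \<eta> (s - x) * \<psi> s)"
  proof (rule sum.cong[OF refl])
    fix x
    show "(\<Sum>y\<in>UNIV. \<rho> x * \<eta> y * \<psi> (x + y)) = (\<Sum>s\<in>UNIV. \<rho> x * \<eta> (s - x) * \<psi> s)"
      by (rule sum.reindex_bij_witness[of _ "\<lambda>s. s - x" "\<lambda>y. x + y"]) auto
  qed
  also have "\<dots> = (\<Sum>s\<in>UNIV. \<psi> s * (\<Sum>x\<in>UNIV. \<rho> x * \<eta> (s - x)))"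
    by (subst sum.swap) (simp add: sum_distrib_left mult_ac)
  also have "\<dots> = jacobi_sum \<rho> \<eta> * gauss_sum (\<lambda>x. \<rho> x * \<eta> x) \<psi>"
    by (simp add: inner gauss_sum_def sum_distrib_left mult_ac)
  finally show ?thesis .
qed

section \<open>The spectrum of a Cayley sum graph\<close>

text \<open>The columns of \<open>B\<close> are eigenvectors, so \<open>xI - A\<close> times
  \<open>B\<close> equals \<open>B\<close> times a diagonal matrix. Orthogonality makes
  \<open>det B\<close> nonzero, hence it cancels.\<close>

lemma charpoly_eq_prod_eigenvalues:
  fixes A B :: "complex ^ 'n::finite ^ 'n" and d :: "'n \<Rightarrow> complex"
  assumes eig: "\<And>v a. (\<Sum>w\<in>UNIV. A $ v $ w * B $ w $ a) = B $ v $ a * d a"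
    and orth: "\<And>a b. a \<noteq> b \<Longrightarrow> (\<Sum>v\<in>UNIV. cnj (B $ v $ a) * B $ v $ b) = 0"
    and nz: "\<And>a. (\<Sum>v\<in>UNIV. cnj (B $ v $ a) * B $ v $ a) \<noteq> 0"
  shows "charpoly A = (\<Prod>a\<in>UNIV. [:- d a, 1:])"
proof -
  let ?B = "(\<chi> i j. [:B $ i $ j:]) :: complex poly ^ 'n ^ 'n"
  let ?B' = "(\<chi> i j. [:cnj (B $ j $ i):]) :: complex poly ^ 'n ^ 'n"
  let ?D = "(\<chi> i j. if i = j then [:- d i, 1:] else 0) :: complex poly ^ 'n ^ 'n"
  let ?M = "mat [:0, 1:] - (\<chi> i j. [:A $ i $ j:]) :: complex poly ^ 'n ^ 'n"
  have const_sum: "(\<Sum>k\<in>S. [:f k:]) = [:\<Sum>k\<in>S. f k:]" for f :: "'n \<Rightarrow> complex" and S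
    by (induction S rule: infinite_finite_induct) auto
  have "?M ** ?B = ?B ** ?D"
  proof -
    have "(?M ** ?B) $ i $ j = (?B ** ?D) $ i $ j" for i j
    proof -
      have "(?M ** ?B) $ i $ j
          = (\<Sum>k\<in>UNIV. (if i = k then [:0, 1:] else 0) * [:B $ k $ j:]) - (\<Sum>k\<in>UNIV. [:A $ i $ k * B $ k $ j:])"
        by (simp add: matrix_matrix_mult_def mat_def smult_diff_right mult.commute flip: sum_subtractf)
      also have "(\<Sum>k\<in>UNIV. (if i = k then [:0, 1:] else 0) * [:B $ k $ j:])
          = (\<Sum>k\<in>UNIV. if i = k then [:0, 1:] * [:B $ k $ j:] else 0)"
        by (intro sum.cong refl) auto
      also have "\<dots> = [:0, B $ i $ j:]" by simp
      also have "(\<Sum>k\<in>UNIV. [:A $ i $ k * B $ k $ j:]) = [:B $ i $ j * d j:]"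
        by (simp only: const_sum eig)
      also have "[:0, B $ i $ j:] - [:B $ i $ j * d j:] = [:B $ i $ j:] * [:- d j, 1:]" by simp
      also have "\<dots> = (\<Sum>k\<in>UNIV. if k = j then [:B $ i $ k:] * [:- d k, 1:] else 0)" by simp
      also have "\<dots> = (?B ** ?D) $ i $ j"
        unfolding matrix_matrix_mult_def vec_lambda_beta by (intro sum.cong refl) auto
      finally show ?thesis .
    qed
    then show ?thesis by (simp add: vec_eq_iff)
  qed
  then have "det ?M * det ?B = det ?B * det ?D" unfolding det_mul[symmetric] by (rule arg_cong)
  moreover have "det ?B \<noteq> 0"
  \<comment> \<open>\<open>?B'\<close> is the conjugate transpose of \<open>?B\<close>, and their
    product is the Gram matrix of the columns, which is diagonal with nonzero entries.\<close>
  proof -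
    have e: "(?B' ** ?B) $ i $ j = [:\<Sum>v\<in>UNIV. cnj (B $ v $ i) * B $ v $ j:]" for i j
      by (simp add: matrix_matrix_mult_def const_sum mult.commute)
    have "det (?B' ** ?B) = (\<Prod>i\<in>UNIV. (?B' ** ?B) $ i $ i)"
      by (rule det_diagonal) (use orth in \<open>simp add: e\<close>)
    also have "\<dots> \<noteq> 0" by (simp only: e) (use nz in auto)
    finally show ?thesis by (auto simp: det_mul)
  qed
  ultimately have "det ?M = det ?D" by simp
  also have "\<dots> = (\<Prod>a\<in>UNIV. [:- d a, 1:])" by (subst det_diagonal) auto
  finally show ?thesis by (simp add: charpoly_def)
qed

lemma proots_prod_linear:
  "finite S \<Longrightarrow> proots (\<Prod>a\<in>S. [:- d a, 1 :: complex:]) = image_mset d (mset_set S)"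
proof (induction S rule: finite_induct)
  case (insert x F)
  have "(\<Prod>a\<in>F. [:- d a, 1:]) \<noteq> 0" using insert by auto
  then have "proots ([:- d x, 1:] * (\<Prod>a\<in>F. [:- d a, 1:])) = proots [:- d x, 1:] + proots (\<Prod>a\<in>F. [:- d a, 1:])"
    by (intro proots_mult) auto
  then show ?case using insert by simp
qed simp

text \<open>The function \<open>\<sigma>\<close> chooses a sign on each pair \<open>{a, -a}\<close>; the eigenvector attached to \<open>a\<close> is
  \<open>v \<mapsto> \<psi> (a v) + \<sigma> a \<psi> (- a v)\<close>.\<close>

lemma cayley_sum_spectrum:
  fixes \<psi> :: "'a::{field,finite} \<Rightarrow> complex" and \<sigma> :: "'a \<Rightarrow> complex"
  assumes "additive_character \<psi>"
    and sym: "\<And>r. r \<in> R \<Longrightarrow> - r \<in> R"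
    and sg0: "\<sigma> 0 = 0" and sg: "\<And>a. a \<noteq> 0 \<Longrightarrow> \<sigma> a = 1 \<or> \<sigma> a = - 1" "\<And>a. \<sigma> (- a) = - \<sigma> a"
  shows "graph_spectrum \<lparr>pverts = UNIV, parcs = {(v, w). v + w \<in> R}\<rparr>
    = image_mset (\<lambda>a. if a = 0 then of_nat (card R) else \<sigma> a * (\<Sum>r\<in>R. \<psi> (a * r))) (mset_set UNIV)"
    (is "graph_spectrum ?G = image_mset ?d _")
proof -
  interpret additive_character \<psi> by fact
  let ?A = "adjacency_matrix ?G"
  define \<eta> where "\<eta> a = (\<Sum>r\<in>R. \<psi> (a * r))" for a
  define b where "b v a = \<psi> (a * v) + \<sigma> a * \<psi> (- (a * v))" for v a
  have eta_uminus: "\<eta> (- a) = \<eta> a" for a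
    unfolding \<eta>_def by (rule sum.reindex_bij_witness[of _ uminus uminus]) (use sym in auto)
  \<comment> \<open>Adjacency sends the character of frequency \<open>a\<close> to
    \<open>\<eta> a\<close> times that of frequency \<open>- a\<close>. Hence each pair of opposite
    frequencies spans an invariant space, diagonalised by the sum and the difference of the
    two.\<close>
  have shift: "(\<Sum>w\<in>UNIV. ?A $ v $ w * \<psi> (a * w)) = \<eta> a * \<psi> (- (a * v))" for a v
  proof -
    have "(\<Sum>w\<in>UNIV. ?A $ v $ w * \<psi> (a * w)) = (\<Sum>w\<in>{w. v + w \<in> R}. \<psi> (a * w))"
      by (rule sum.mono_neutral_cong_right) (auto simp: adjacency_matrix_def)
    also have "\<dots> = (\<Sum>r\<in>R. \<psi> (a * (r - v)))"
      by (rule sum.reindex_bij_witness[of _ "\<lambda>r. r - v" "\<lambda>w. v + w"]) auto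
    also have "\<dots> = \<eta> a * \<psi> (- (a * v))"
      unfolding \<eta>_def sum_distrib_right by (simp add: add[symmetric] algebra_simps)
    finally show ?thesis .
  qed
  have sq: "a \<noteq> 0 \<Longrightarrow> \<sigma> a * \<sigma> a = 1" for a using sg(1)[of a] by auto
  have eig: "(\<Sum>w\<in>UNIV. ?A $ v $ w * b w a) = b v a * ?d a" for v a
  proof -
    have "(\<Sum>w\<in>UNIV. ?A $ v $ w * b w a)
        = (\<Sum>w\<in>UNIV. ?A $ v $ w * \<psi> (a * w)) + \<sigma> a * (\<Sum>w\<in>UNIV. ?A $ v $ w * \<psi> (- a * w))"
      by (simp add: b_def algebra_simps sum.distrib sum_distrib_left)
    also have "\<dots> = \<eta> a * \<psi> (- (a * v)) + \<sigma> a * (\<eta> a * \<psi> (a * v))"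
      by (simp only: shift eta_uminus) simp
    also have "\<dots> = b v a * ?d a"
    proof (cases "a = 0")
      case False
      have "b v a * ?d a = \<sigma> a * \<eta> a * \<psi> (a * v) + \<sigma> a * \<sigma> a * (\<eta> a * \<psi> (- (a * v)))"
        using False by (simp add: b_def \<eta>_def algebra_simps)
      then show ?thesis using sq[OF False] by simp
    qed (simp add: b_def sg0 \<eta>_def)
    finally show ?thesis .
  qed
  have cnj_sg: "cnj (\<sigma> a) = \<sigma> a" for a using sg(1)[of a] sg0 by (cases "a = 0") auto
  define e where "e x = (if x = 0 then of_nat CARD('a) else 0 :: complex)" for x :: 'a
  have gram: "(\<Sum>v\<in>UNIV. cnj (b v a) * b v c)
      = e (c - a) + \<sigma> c * e (- c - a) + \<sigma> a * e (a + c) + \<sigma> a * \<sigma> c * e (a - c)" for a c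
  proof -
    have "cnj (b v a) * b v c = \<psi> ((c - a) * v) + \<sigma> c * \<psi> ((- c - a) * v)
        + \<sigma> a * \<psi> ((a + c) * v) + \<sigma> a * \<sigma> c * \<psi> ((a - c) * v)" for v
    proof -
      have "\<psi> ((c - a) * v) = \<psi> (- (a * v)) * \<psi> (c * v)"
        "\<psi> ((- c - a) * v) = \<psi> (- (a * v)) * \<psi> (- (c * v))"
        "\<psi> ((a + c) * v) = \<psi> (a * v) * \<psi> (c * v)"
        "\<psi> ((a - c) * v) = \<psi> (a * v) * \<psi> (- (c * v))"
        unfolding add[symmetric] by (rule arg_cong[where f = \<psi>], simp add: algebra_simps)+
      moreover have "cnj (b v a) = \<psi> (- (a * v)) + \<sigma> a * \<psi> (a * v)"
        by (simp add: b_def cnj_sg uminus)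
      ultimately show ?thesis by (simp add: b_def algebra_simps)
    qed
    then show ?thesis
      by (simp only: sum.distrib sum_distrib_left[symmetric] sum_eq e_def)
  qed
  have "charpoly ?A = (\<Prod>a\<in>UNIV. [:- ?d a, 1:])"
  proof (rule charpoly_eq_prod_eigenvalues[where B = "\<chi> v a. b v a"])
    show "(\<Sum>w\<in>UNIV. ?A $ v $ w * (\<chi> v a. b v a) $ w $ a) = (\<chi> v a. b v a) $ v $ a * ?d a" for v a
      using eig[of v a] by simp
  next
    fix a c :: 'a assume ac: "a \<noteq> c"
    \<comment> \<open>For \<open>c = - a\<close> the two cross terms cancel because
      \<open>\<sigma>\<close> is odd; otherwise both character sums vanish.\<close>
    have "\<sigma> c * e (- c - a) + \<sigma> a * e (a + c) = 0"
    proof (cases "a + c = 0")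
      case True
      then have "c = - a" by (simp add: eq_neg_iff_add_eq_0 add.commute)
      then show ?thesis by (simp add: sg(2))
    next
      case False
      then have "- c - a \<noteq> 0" by (metis add.commute diff_eq_eq neg_eq_iff_add_eq_0 add_0)
      then show ?thesis using False by (simp add: e_def)
    qed
    then show "(\<Sum>v\<in>UNIV. cnj ((\<chi> v a. b v a) $ v $ a) * (\<chi> v a. b v a) $ v $ c) = 0"
      using gram[of a c] ac by (simp add: e_def)
  next
    fix a :: 'a
    have "(\<Sum>v\<in>UNIV. cnj (b v a) * b v a) \<noteq> 0"
    proof (cases "a = 0")
      case False
      \<comment> \<open>An odd function with values 1 and -1 cannot exist at a nonzero point with
        \<open>a = - a\<close>.\<close>
      have aa: "a + a \<noteq> 0"
      proof
        assume "a + a = 0"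
        then have "- a = a" by (rule minus_unique)
        then have "\<sigma> a = - \<sigma> a" using sg(2)[of a] by metis
        then show False using sg(1)[OF False] by auto
      qed
      have "- a - a = - (a + a)" by simp
      then have "- a - a \<noteq> 0" using aa by (metis neg_equal_0_iff_equal)
      then have "e (- a - a) = 0" unfolding e_def by (rule if_not_P)
      moreover have "e (a + a) = 0" using aa unfolding e_def by (rule if_not_P)
      moreover have "e (a - a) = of_nat CARD('a)" by (simp add: e_def)
      ultimately show ?thesis unfolding gram[of a a] sq[OF False] by simp
    qed (use gram[of 0 0] in \<open>simp add: sg0 e_def\<close>)
    then show "(\<Sum>v\<in>UNIV. cnj ((\<chi> v a. b v a) $ v $ a) * (\<chi> v a. b v a) $ v $ a) \<noteq> 0" by simp
  qed
  then show ?thesis unfolding graph_spectrum_def by (simp only: proots_prod_linear[OF finite])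
qed

section \<open>Connectedness\<close>

text \<open>If \<open>K\<close> were proper, then \<open>(a, b) \<mapsto> a + x b\<close> would be injective on \<open>K \<times> K\<close> for every \<open>x \<notin> K\<close>.\<close>

lemma large_subring_eq_UNIV:
  fixes K :: "'a::{field,finite} set"
  assumes add: "\<And>x y. x \<in> K \<Longrightarrow> y \<in> K \<Longrightarrow> x + y \<in> K"
    and uminus: "\<And>x. x \<in> K \<Longrightarrow> - x \<in> K"
    and mult: "\<And>x y. x \<in> K \<Longrightarrow> y \<in> K \<Longrightarrow> x * y \<in> K"
    and one: "1 \<in> K"
    and large: "CARD('a) < card K ^ 2"
  shows "K = UNIV"
proof (rule ccontr)
  assume "K \<noteq> UNIV"
  then obtain x where x: "x \<notin> K" by blast
  have power: "y ^ k \<in> K" if "y \<in> K" for y k using that one mult by (induction k) auto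
  \<comment> \<open>In a finite field the inverse is a power, so closure under products
    suffices.\<close>
  have inverse: "inverse y \<in> K" if "y \<in> K" "y \<noteq> 0" for y
  proof -
    have "CARD('a) > 1" using card_mono[of UNIV "{0,1::'a}"] by simp
    then have "CARD('a) - 1 = Suc (CARD('a) - 2)" by simp
    then have "y * y ^ (CARD('a) - 2) = y ^ (CARD('a) - 1)" by (simp only: power_Suc)
    then have "y * y ^ (CARD('a) - 2) = 1" using power_CARD_minus_1[of y] that by simp
    then have "inverse y = y ^ (CARD('a) - 2)" by (rule inverse_unique)
    then show ?thesis using power that by simp
  qed
  have "inj_on (\<lambda>(a, b). a + x * b) (K \<times> K)"
  proof (rule inj_onI, clarify)
    fix a b c d assume K: "a \<in> K" "b \<in> K" "c \<in> K" "d \<in> K" and eq: "a + x * b = c + x * d"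
    have "b = d"
    proof (rule ccontr)
      assume "b \<noteq> d"
      then have "b + - d \<noteq> 0" by simp
      moreover have "x * (b + - d) = c + - a" using eq by algebra
      ultimately have "x = (c + - a) / (b + - d)" by (metis nonzero_eq_divide_eq)
      then have "x = (c + - a) * inverse (b + - d)" by (simp only: divide_inverse)
      moreover have "(c + - a) * inverse (b + - d) \<in> K"
        using K \<open>b \<noteq> d\<close> by (intro mult add uminus inverse) (auto simp: add_eq_0_iff)
      ultimately show False using x by simp
    qed
    then show "a = c \<and> b = d" using eq by simp
  qed
  then have "card (K \<times> K) = card ((\<lambda>(a, b). a + x * b) ` (K \<times> K))" by (simp add: card_image)
  also have "\<dots> \<le> CARD('a)" by (intro card_mono) auto
  finally show False using large by (simp add: power2_eq_square)
qed

text \<open>The translations that preserve every component form an additive group \<open>H\<close> containing \<open>R\<close>. Since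
  multiplication by an element of \<open>R\<close> is an automorphism of the graph, the subring \<open>K\<close> of multipliers
  of \<open>H\<close> contains \<open>R\<close> as well.\<close>

lemma cayley_sum_graph_connected:
  fixes R :: "'a::{field,finite} set"
  assumes one: "1 \<in> R" and uminus: "\<And>r. r \<in> R \<Longrightarrow> - r \<in> R"
    and mult: "\<And>r s. r \<in> R \<Longrightarrow> s \<in> R \<Longrightarrow> r * s \<in> R"
    and odd: "odd CARD('a)" and large: "CARD('a) < (card R + 1) ^ 2" and zero: "0 \<notin> R"
  shows "Digraph_Component.connected (with_proj \<lparr>pverts = UNIV, parcs = {(v, w). v + w \<in> R}\<rparr>)"
proof -
  let ?E = "{(v, w). v + w \<in> R}"
  define H where "H = {u. \<forall>v. (v, v + u) \<in> ?E\<^sup>*}"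
  have H_add: "x + y \<in> H" if "x \<in> H" "y \<in> H" for x y
    unfolding H_def
  proof (intro CollectI allI)
    fix v
    have "(v, v + x) \<in> ?E\<^sup>*" "(v + x, v + x + y) \<in> ?E\<^sup>*" using that by (simp_all only: H_def mem_Collect_eq)
    then show "(v, v + (x + y)) \<in> ?E\<^sup>*" unfolding add.assoc by (rule rtrancl_trans)
  qed
  have H_0: "0 \<in> H" by (simp add: H_def)
  have H_mult_nat: "of_nat k * x \<in> H" if "x \<in> H" for k x
    using that H_0 H_add by (induction k) (auto simp: distrib_right)
  have CARD0: "of_nat CARD('a) = (0::'a)"
    using CHAR_dvd_CARD[where 'a='a] by (simp add: of_nat_eq_0_iff_char_dvd)
  have H_uminus: "- x \<in> H" if "x \<in> H" for x
  proof -
    have "of_nat (CARD('a) - 1) * x = - x"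
      using CARD0 by (subst of_nat_diff) (auto simp: Suc_leI algebra_simps)
    then show ?thesis using H_mult_nat[OF that] by metis
  qed
  have two_R: "r + s \<in> H" if "r \<in> R" "s \<in> R" for r s
  proof -
    \<comment> \<open>A walk of two steps: the endpoints of its arcs sum to \<open>- r\<close> and
      to \<open>s\<close>.\<close>
    have "(v, v + (r + s)) \<in> ?E\<^sup>*" for v
    proof -
      have "(v, - r - v) \<in> ?E" using uminus[OF that(1)] by simp
      moreover have "(- r - v, v + (r + s)) \<in> ?E" using that by simp
      ultimately show ?thesis by (rule r_into_rtrancl[THEN rtrancl_into_rtrancl])
    qed
    then show ?thesis by (simp add: H_def)
  qed
  have R_H: "r \<in> H" if "r \<in> R" for r
  proof -
    \<comment> \<open>Halving: \<open>k\<close> is an inverse of 2 because \<open>CARD('a)\<close>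
      is odd and equals zero in the field.\<close>
    obtain k where k: "CARD('a) + 1 = 2 * k" using odd by (metis even_add odd_one dvdE)
    have "of_nat k * (r + r) = of_nat (2 * k) * r" by (simp add: algebra_simps)
    also have "\<dots> = r" using CARD0 by (simp only: k[symmetric]) simp
    finally show ?thesis using H_mult_nat[OF two_R[OF that that], of k] by (simp only:)
  qed
  define K where "K = {x. \<forall>u\<in>H. x * u \<in> H}"
  have R_K: "R \<subseteq> K"
  proof
    fix r assume r: "r \<in> R"
    then have r0: "r \<noteq> 0" using zero by auto
    have scale: "(r * v, r * w) \<in> ?E\<^sup>*" if "(v, w) \<in> ?E\<^sup>*" for v w
      using that
    proof (induction rule: rtrancl_induct)
      case (step y z)
      have "r * y + r * z \<in> R" using mult[OF r, of "y + z"] step by (simp add: distrib_left)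
      then have "(r * y, r * z) \<in> ?E" by simp
      with step.IH show ?case by (rule rtrancl_into_rtrancl)
    qed simp
    have "r * u \<in> H" if "u \<in> H" for u
    proof -
      have "(v, v + r * u) \<in> ?E\<^sup>*" for v
      proof -
        have "(v / r, v / r + u) \<in> ?E\<^sup>*" using that by (simp add: H_def)
        from scale[OF this] show ?thesis using r0 by (simp add: distrib_left)
      qed
      then show ?thesis by (simp add: H_def)
    qed
    then show "r \<in> K" by (simp add: K_def)
  qed
  have "K = UNIV"
  proof (rule large_subring_eq_UNIV)
    show "x + y \<in> K" if "x \<in> K" "y \<in> K" for x y using that H_add by (simp add: K_def distrib_right)
    show "- x \<in> K" if "x \<in> K" for x using that H_uminus by (simp add: K_def)
    show "x * y \<in> K" if "x \<in> K" "y \<in> K" for x y using that by (simp add: K_def mult.assoc)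
    show "1 \<in> K" by (simp add: K_def)
    \<comment> \<open>Including 0 in the count matches the bound \<open>card R + 1\<close> of the
      hypothesis.\<close>
    have "card (insert 0 R) \<le> card K" using R_K H_0 by (intro card_mono) (auto simp: K_def)
    then have "card R + 1 \<le> card K" using zero by simp
    then have "(card R + 1) ^ 2 \<le> card K ^ 2" by (rule power_mono) simp
    then show "CARD('a) < card K ^ 2" using large by linarith
  qed
  then have mem: "u * 1 \<in> H" for u using R_H[OF one] unfolding K_def by blast
  then have E: "(v, w) \<in> ?E\<^sup>*" for v w
  proof -
    have "w - v \<in> H" using mem[of "w - v"] by simp
    then have "(v, v + (w - v)) \<in> ?E\<^sup>*" unfolding H_def by blast
    then show ?thesis by simp
  qed
  have on: "(v, w) \<in> rtrancl_on UNIV ?E" for v w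
    using E[of v w] by (induction rule: rtrancl_induct) (auto intro: rtrancl_on_into_rtrancl_on)
  have "parcs (mk_symmetric (with_proj \<lparr>pverts = UNIV, parcs = ?E\<rparr>)) = ?E"
    by (auto simp: mk_symmetric_def add.commute)
  then show ?thesis
    using on by (simp add: connected_def strongly_connected_def reachable_def)
qed

section \<open>Binomial coefficients and sums of two squares\<close>

text \<open>The multiples of \<open>p\<close> among the factors contribute
  \<open>p ^ a * fact a\<close>; \<open>u\<close> is the product of the remaining factors.\<close>

lemma fact_mult_add_coprime:
  assumes p: "prime p" and b: "b < p"
  shows "\<exists>u. \<not> p dvd u \<and> fact (p * a + b) = p ^ a * fact a * (u::nat)"
  using b
proof (induction a arbitrary: b)
  case 0
  then show ?case using p by (intro exI[of _ "fact b"]) (simp add: prime_dvd_fact_iff)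
next
  case (Suc a)
  show ?case using Suc.prems
  proof (induction b)
    case 0
    have p1: "p - 1 < p" using p prime_gt_0_nat by force
    from Suc.IH[OF p1] obtain u
      where u: "\<not> p dvd u" "fact (p * a + (p - 1)) = p ^ a * fact a * u" by blast
    have "p * Suc a + 0 = Suc (p * a + (p - 1))" using p1 by simp
    then have "fact (p * Suc a + 0) = (p * Suc a) * fact (p * a + (p - 1))"
      by (metis add_0_right fact_Suc of_nat_id)
    also have "\<dots> = p ^ Suc a * fact (Suc a) * u" unfolding u fact_Suc power_Suc of_nat_id by (simp only: mult_ac)
    finally show ?case using u(1) by blast
  next
    case (Suc b)
    then obtain u where u: "\<not> p dvd u" "fact (p * Suc a + b) = p ^ Suc a * fact (Suc a) * u" by auto
    have "\<not> p dvd (p * Suc a + Suc b)"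
      using Suc.prems by (metis dvd_add_right_iff dvd_triv_left nat_dvd_not_less zero_less_Suc)
    then have "\<not> p dvd u * (p * Suc a + Suc b)" using u(1) p prime_dvd_mult_iff by blast
    moreover have "fact (p * Suc a + Suc b) = (p * Suc a + Suc b) * fact (p * Suc a + b)"
      by (metis add_Suc_right fact_Suc of_nat_id)
    then have "fact (p * Suc a + Suc b) = p ^ Suc a * fact (Suc a) * (u * (p * Suc a + Suc b))"
      unfolding u by (simp only: mult_ac)
    ultimately show ?case by blast
  qed
qed

text \<open>The base \<open>p\<close> digits of \<open>n = (p\<^sup>m - 1) / 4\<close> are all \<open>(p - 1) / 4\<close>, so no carry occurs in \<open>n + 2 n\<close>.\<close>

lemma not_dvd_binomial_quarter:
  assumes p: "prime p" and e: "p = 4 * e + 1" and n: "p ^ m = 4 * n + 1"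
  shows "\<not> p dvd ((3 * n) choose n)"
  using n
proof (induction m arbitrary: n)
  case 0
  then show ?case using p by (simp add: prime_nat_iff)
next
  case (Suc m)
  obtain n' where n': "p ^ m = 4 * n' + 1"
  proof -
    have "[p ^ m = 1 ^ m] (mod 4)" by (rule cong_pow) (simp add: e cong_def)
    then have "p ^ m mod 4 = 1" by (simp add: cong_def)
    then have "p ^ m = 4 * (p ^ m div 4) + 1" by presburger
    then show ?thesis using that by blast
  qed
  have "4 * n + 1 = p * (4 * n' + 1)" using Suc.prems n' by simp
  also have "\<dots> = 4 * (p * n' + e) + 1" using e by (simp add: algebra_simps)
  finally have n: "n = p * n' + e" by simp
  have b1: "e < p" and b2: "2 * e < p" and b3: "3 * e < p" using e by simp_all
  obtain u1 where u1: "\<not> p dvd u1" "fact (p * n' + e) = p ^ n' * fact n' * u1"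
    using fact_mult_add_coprime[OF p b1] by blast
  obtain u2 where u2: "\<not> p dvd u2" "fact (p * (2 * n') + 2 * e) = p ^ (2 * n') * fact (2 * n') * u2"
    using fact_mult_add_coprime[OF p b2] by blast
  obtain u3 where u3: "\<not> p dvd u3" "fact (p * (3 * n') + 3 * e) = p ^ (3 * n') * fact (3 * n') * u3"
    using fact_mult_add_coprime[OF p b3] by blast
  have 2: "2 * n = p * (2 * n') + 2 * e" and 3: "3 * n = p * (3 * n') + 3 * e"
    by (simp_all add: n algebra_simps)
  have bin: "fact k * fact (2 * k) * ((3 * k) choose k) = (fact (3 * k) :: nat)" for k
    using binomial_fact_lemma[of k "3 * k"] by simp
  have "fact n * fact (2 * n) * ((3 * n) choose n) = (fact (3 * n) :: nat)" by (rule bin)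
  \<comment> \<open>The three factorials split with matching powers of \<open>p\<close>, as the
    digits add without carry. Cancelling them relates the binomials for \<open>n\<close> and
    \<open>n'\<close> up to factors prime to \<open>p\<close>.\<close>
  then have "(p ^ n' * fact n' * u1) * (p ^ (2 * n') * fact (2 * n') * u2) * ((3 * n) choose n)
      = p ^ (3 * n') * (fact n' * fact (2 * n') * ((3 * n') choose n')) * u3"
    unfolding bin 2 3 u2 u3 using u1 n by simp
  then have "(p ^ (3 * n') * fact n' * fact (2 * n')) * (u1 * u2 * ((3 * n) choose n))
      = (p ^ (3 * n') * fact n' * fact (2 * n')) * (((3 * n') choose n') * u3)"
  proof -
    have "p ^ (3 * n') = p ^ n' * p ^ (2 * n')" by (simp flip: power_add)
    then show ?thesis
      using \<open>(p ^ n' * fact n' * u1) * _ * _ = _\<close> by (simp add: mult_ac)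
  qed
  moreover have "p ^ (3 * n') * fact n' * fact (2 * n') \<noteq> (0::nat)" using p by (auto dest: prime_gt_0_nat)
  ultimately have "u1 * u2 * ((3 * n) choose n) = ((3 * n') choose n') * u3" by (metis mult_left_cancel)
  moreover have "\<not> p dvd ((3 * n') choose n') * u3"
    using Suc.IH[OF n'] u3(1) p prime_dvd_mult_iff by blast
  ultimately show ?case by (metis dvd_mult)
qed

text \<open>The two representations make \<open>p ^ k\<close> divide
  \<open>(c * d' - c' * d) * (c * d' + c' * d)\<close>. Since \<open>p\<close> cannot divide both
  factors, \<open>p ^ k\<close> divides one of them; that factor is too small to be nonzero, so the
  representations are proportional.\<close>

lemma sum_two_squares_unique:
  fixes c d c' d' :: int
  assumes p: "prime p" "odd p"
    and eq: "c\<^sup>2 + 4 * d\<^sup>2 = int p ^ k" "c'\<^sup>2 + 4 * d'\<^sup>2 = int p ^ k" and k: "k > 0"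
    and cop: "coprime c (int p)" "coprime c' (int p)"
    and cong: "[c = 1] (mod 4)" "[c' = 1] (mod 4)"
  shows "c' = c \<and> (d' = d \<or> d' = - d)"
proof -
  let ?P = "int p ^ k"
  have ip: "prime (int p)" using p by simp
  have p3: "p \<ge> 3" using p by (metis One_nat_def Suc_leI even_numeral le_neq_implies_less numeral_2_eq_2 numeral_3_eq_3 prime_ge_2_nat)
  have P: "?P > 0" using p3 by simp
  have P_dvd: "int p dvd ?P" using k by simp
  have ndvd: "\<not> int p dvd c" "\<not> int p dvd c'"
    using cop ip by (metis coprime_commute not_coprimeI not_prime_unit dvd_refl)+
  \<comment> \<open>Here \<open>b\<close> stands for \<open>d'\<close> or \<open>- d'\<close>,
    whichever makes the divisible factor the difference.\<close>
  have aligned: "c' = c \<and> b = d" if b: "c'\<^sup>2 + 4 * b\<^sup>2 = ?P" and dvd: "?P dvd c * b - c' * d" for b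
  proof -
    obtain t where t: "c * b - c' * d = ?P * t" using dvd by (elim dvdE)
    \<comment> \<open>The composition identity for the norm form bounds the difference by half of
      \<open>?P\<close> in absolute value.\<close>
    have "(c * c' + 4 * d * b)\<^sup>2 + 4 * (c * b - c' * d)\<^sup>2 = (c\<^sup>2 + 4 * d\<^sup>2) * (c'\<^sup>2 + 4 * b\<^sup>2)"
      by (simp add: power2_eq_square algebra_simps)
    also have "\<dots> = ?P\<^sup>2" unfolding eq(1) b by (rule power2_eq_square[symmetric])
    finally have "4 * (c * b - c' * d)\<^sup>2 \<le> ?P\<^sup>2" using zero_le_power2[of "c * c' + 4 * d * b"] by linarith
    then have "4 * (?P * t)\<^sup>2 \<le> ?P\<^sup>2" unfolding t .
    then have "?P\<^sup>2 * (4 * t\<^sup>2) \<le> ?P\<^sup>2 * 1" by (simp only: power_mult_distrib mult_ac mult_1_right mult_1_left)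
    then have "4 * t\<^sup>2 \<le> 1" using P by (metis mult_le_cancel_left_pos zero_less_power)
    then have "t = 0" using zero_less_power2[of t] by linarith
    then have cross: "c * b = c' * d" using t by simp
    have "c'\<^sup>2 * ?P = (c' * c)\<^sup>2 + 4 * (c' * d)\<^sup>2" by (simp add: eq(1)[symmetric] power_mult_distrib algebra_simps)
    also have "\<dots> = c\<^sup>2 * (c'\<^sup>2 + 4 * b\<^sup>2)" by (simp add: cross[symmetric] power_mult_distrib algebra_simps)
    finally have "c'\<^sup>2 = c\<^sup>2" using P unfolding b by auto
    then have "c' = c \<or> c' = - c" by (simp add: power2_eq_iff)
    \<comment> \<open>Both numbers are 1 modulo 4, which settles the sign.\<close>
    moreover have "(c + c') mod 4 = 2" using mod_add_eq[of c 4 c'] cong by (simp add: cong_def)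
    then have "c' \<noteq> - c" by auto
    ultimately have cc: "c' = c" by blast
    moreover have "c \<noteq> 0" using ndvd by auto
    ultimately show ?thesis using cross by simp
  qed
  have "(c * d' - c' * d) * (c * d' + c' * d) = c\<^sup>2 * d'\<^sup>2 - c'\<^sup>2 * d\<^sup>2"
    by (simp add: power2_eq_square algebra_simps)
  also have "\<dots> = (?P - 4 * d\<^sup>2) * d'\<^sup>2 - (?P - 4 * d'\<^sup>2) * d\<^sup>2"
    using eq by (metis add_diff_cancel_right')
  also have "\<dots> = ?P * (d'\<^sup>2 - d\<^sup>2)" by (simp add: algebra_simps)
  finally have prod: "?P dvd (c * d' - c' * d) * (c * d' + c' * d)" by simp
  have "\<not> (int p dvd c * d' - c' * d \<and> int p dvd c * d' + c' * d)"
  proof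
    assume both: "int p dvd c * d' - c' * d \<and> int p dvd c * d' + c' * d"
    have "int p dvd (c * d' - c' * d) + (c * d' + c' * d)"
      using both by (intro dvd_add[OF conjunct1 conjunct2])
    then have "int p dvd 2 * c * d'" by (simp add: algebra_simps)
    moreover have "\<not> int p dvd 2" using p3 zdvd_imp_le[of "int p" 2] by auto
    ultimately have "int p dvd d'" using ndvd ip by (simp add: prime_dvd_mult_iff)
    then have "int p dvd 4 * d'\<^sup>2" by (simp add: power2_eq_square)
    then have "int p dvd c'\<^sup>2" using P_dvd eq(2) by (metis dvd_add_left_iff)
    then show False using ndvd ip by (simp add: prime_dvd_power_iff)
  qed
  then consider "coprime ?P (c * d' + c' * d)" | "coprime ?P (c * d' - c' * d)"
    using ip by (metis coprime_power_left_iff prime_imp_coprime)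
  then show ?thesis
  proof cases
    case 1
    then have "?P dvd c * d' - c' * d" using prod coprime_dvd_mult_left_iff by blast
    then show ?thesis using aligned[OF eq(2)] by blast
  next
    case 2
    then have "?P dvd c * d' + c' * d" using prod coprime_dvd_mult_right_iff by blast
    then have "?P dvd - (c * d' + c' * d)" by (simp only: dvd_minus_iff)
    then have "?P dvd c * (- d') - c' * d" by simp
    then show ?thesis using aligned[of "- d'"] eq(2) by auto
  qed
qed

section \<open>The quartic character and quartic periods\<close>

text \<open>Here \<open>h\<close> is a primitive fourth root of unity in a field of odd
  characteristic. Evenness of \<open>n\<close> makes -1 a fourth power, so the set of fourth powers
  is symmetric.\<close>

locale quartic_field =
  fixes h :: "'a::{field,finite}" and n :: nat
  assumes card: "CARD('a) = 4 * n + 1" and n_pos: "n > 0" and n_even: "even n"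
    and h: "h * h = - 1" and one_neq: "(1::'a) \<noteq> - 1"
begin

text \<open>For nonzero \<open>x\<close> the power \<open>x ^ n\<close> is a fourth root of unity in
  the field; \<open>\<rho>\<close> transports it to the complex numbers by sending \<open>h\<close>
  to \<open>\<i>\<close>. The final default is reached only at \<open>x = 0\<close>.\<close>

definition \<rho> :: "'a \<Rightarrow> complex" where
  "\<rho> x = (if x ^ n = 1 then 1 else if x ^ n = h then \<i> else if x ^ n = - 1 then - 1
          else if x ^ n = - h then - \<i> else 0)"

lemma h_neq [simp]: "h \<noteq> 0" "h \<noteq> 1" "h \<noteq> - 1" "- h \<noteq> 1" "- h \<noteq> h" "h \<noteq> - h" "1 \<noteq> h" "- 1 \<noteq> h"
    "- h \<noteq> - 1" "- 1 \<noteq> - h" "- 1 \<noteq> (1::'a)" "1 \<noteq> - (1::'a)" "1 \<noteq> - h"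
proof -
  show 0: "h \<noteq> 0" using h by auto
  show 1: "h \<noteq> 1" using h one_neq by auto
  show 2: "h \<noteq> - 1" using h one_neq by auto
  show 3: "- h \<noteq> h"
  proof
    assume "- h = h"
    then have "- 1 * h = 1 * h" by simp
    then have "- 1 = (1::'a)" using 0 by (metis mult_right_cancel)
    then show False using one_neq by simp
  qed
  show "- h \<noteq> 1" using 2 by (metis minus_minus)
  then show "1 \<noteq> - h" by metis
  show "h \<noteq> - h" "1 \<noteq> h" "- 1 \<noteq> h" using 1 2 3 by metis+
  show "- h \<noteq> - 1" "- 1 \<noteq> - h" using 1 by (metis neg_equal_iff_equal)+
  show "- 1 \<noteq> (1::'a)" "1 \<noteq> - (1::'a)" using one_neq by metis+
qed

lemma power_n_cases:
  assumes "x \<noteq> 0"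
  obtains "x ^ n = 1" | "x ^ n = h" | "x ^ n = - 1" | "x ^ n = - h"
proof -
  let ?y = "x ^ n"
  have "x ^ (4 * n) = 1" using power_CARD_minus_1[OF assms] card by simp
  then have "?y ^ 4 = 1" by (simp add: mult.commute flip: power_mult)
  moreover have "(?y - 1) * (?y + 1) * ((?y - h) * (?y + h)) = ?y ^ 4 - 1"
  proof -
    have "(?y - h) * (?y + h) = ?y * ?y - h * h" by (simp add: algebra_simps)
    also have "\<dots> = ?y * ?y + 1" by (simp add: h)
    finally have *: "(?y - h) * (?y + h) = ?y * ?y + 1" .
    show ?thesis unfolding * by (simp add: power4_eq_xxxx algebra_simps)
  qed
  ultimately have "(?y - 1) * (?y + 1) * ((?y - h) * (?y + h)) = 0" by simp
  then have "?y - 1 = 0 \<or> ?y + 1 = 0 \<or> ?y - h = 0 \<or> ?y + h = 0" by (auto simp only: mult_eq_0_iff)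
  then show thesis using that by (auto simp: add_eq_0_iff2)
qed

lemma zero_power_n [simp]: "(0::'a) ^ n = 0" using n_pos by simp

lemma \<rho>_values:
  "x ^ n = 1 \<Longrightarrow> \<rho> x = 1" "x ^ n = h \<Longrightarrow> \<rho> x = \<i>" "x ^ n = - 1 \<Longrightarrow> \<rho> x = - 1" "x ^ n = - h \<Longrightarrow> \<rho> x = - \<i>"
  by (auto simp: \<rho>_def)

sublocale multiplicative_character \<rho>
proof
  show "\<rho> 0 = 0" by (simp add: \<rho>_def)
  show "\<rho> 1 = 1" by (simp add: \<rho>_def)
  show "\<rho> (x * y) = \<rho> x * \<rho> y" for x y
  proof (cases "x = 0 \<or> y = 0")
    case False
    then have "x \<noteq> 0" "y \<noteq> 0" by auto
    then show ?thesis
      by (elim power_n_cases) (simp_all add: \<rho>_def power_mult_distrib h)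
  qed (auto simp: \<rho>_def)
qed

text \<open>The four fibres cover all \<open>4 * n\<close> nonzero elements, and each is the root
  set of a polynomial of degree \<open>n\<close>; so every bound is attained.\<close>

lemma card_fibre:
  assumes "c \<in> {1, h, - 1, - h}"
  shows "card {x. x ^ n = c} = n"
proof -
  let ?C = "\<lambda>c::'a. {x. x ^ n = c}"
  have "UNIV - {0} \<subseteq> ?C 1 \<union> ?C h \<union> ?C (- 1) \<union> ?C (- h)"
    using power_n_cases by blast
  then have "card (UNIV - {0::'a}) \<le> card (?C 1 \<union> ?C h \<union> ?C (- 1) \<union> ?C (- h))"
    by (intro card_mono) auto
  also have "\<dots> \<le> card (?C 1) + card (?C h) + card (?C (- 1)) + card (?C (- h))"
    using card_Un_le[of "?C 1 \<union> ?C h \<union> ?C (- 1)" "?C (- h)"]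
      card_Un_le[of "?C 1 \<union> ?C h" "?C (- 1)"] card_Un_le[of "?C 1" "?C h"] by linarith
  finally have "4 * n \<le> card (?C 1) + card (?C h) + card (?C (- 1)) + card (?C (- h))"
    using card by simp
  moreover have "card (?C c) \<le> n" for c using card_power_eq_le[OF n_pos] by blast
  from this[of 1] this[of h] this[of "- 1"] this[of "- h"]
  have "card (?C 1) \<le> n" "card (?C h) \<le> n" "card (?C (- 1)) \<le> n" "card (?C (- h)) \<le> n" .
  ultimately have "card (?C 1) = n" "card (?C h) = n" "card (?C (- 1)) = n" "card (?C (- h)) = n"
    by linarith+
  then show ?thesis using assms by auto
qed

text \<open>One inclusion is Fermat's identity. For equality, each fourth power has at most four
  roots, so the \<open>4 * n\<close> nonzero elements yield at least \<open>n\<close> fourth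
  powers.\<close>

lemma kth_powers_4: "kth_powers 4 = {x::'a. x ^ n = 1}"
proof (rule card_seteq)
  show "kth_powers 4 \<subseteq> {x::'a. x ^ n = 1}"
  proof
    fix y :: 'a assume "y \<in> kth_powers 4"
    then obtain x where x: "x \<noteq> 0" "y = x ^ 4" by (auto simp: kth_powers_def)
    have "y ^ n = x ^ (CARD('a) - 1)" by (simp add: x card flip: power_mult)
    then show "y \<in> {x. x ^ n = 1}" using power_CARD_minus_1 x by simp
  qed
  have "UNIV - {0::'a} \<subseteq> (\<Union>y\<in>kth_powers 4. {x. x ^ 4 = y})" by (auto simp: kth_powers_def)
  then have "card (UNIV - {0::'a}) \<le> card (\<Union>y\<in>kth_powers 4. {x::'a. x ^ 4 = y})"
    by (intro card_mono) auto
  also have "\<dots> \<le> (\<Sum>y\<in>kth_powers 4. card {x::'a. x ^ 4 = y})" by (rule card_UN_le) simp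
  also have "\<dots> \<le> (\<Sum>y\<in>(kth_powers 4 :: 'a set). 4)" by (intro sum_mono card_power_eq_le) simp
  finally show "card {x::'a. x ^ n = 1} \<le> card (kth_powers 4 :: 'a set)"
    using card card_fibre[of 1] by simp
qed simp

lemma \<rho>_minus_1 [simp]: "\<rho> (- 1) = 1" using n_even by (simp add: \<rho>_def)

lemma \<rho>_uminus [simp]: "\<rho> (- x) = \<rho> x" using chi_mult[of "- 1" x] by simp

lemma obtain_fibre_h: obtains z where "z \<noteq> 0" "z ^ n = h"
proof -
  have "{x. x ^ n = h} \<noteq> {}" using card_fibre[of h] n_pos by force
  then obtain z where "z ^ n = h" by blast
  moreover from this have "z \<noteq> 0" by (metis h_neq(1) zero_power_n)
  ultimately show thesis using that by blast
qed

lemma multiplicative_character_square: "multiplicative_character (\<lambda>x. \<rho> x * \<rho> x)"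
  by unfold_locales (simp_all add: chi_mult)

lemma square_nontrivial: obtains z where "z \<noteq> 0" "\<rho> z * \<rho> z \<noteq> 1" "\<rho> z \<noteq> 1"
proof -
  obtain z where z: "z \<noteq> 0" "z ^ n = h" by (rule obtain_fibre_h)
  then have "\<rho> z = \<i>" by (simp add: \<rho>_values)
  then show thesis using that[of z] z by simp
qed

section \<open>Gauss sums and quartic periods of a fixed additive character\<close>

context
  fixes \<psi> :: "'a \<Rightarrow> complex"
  assumes psi: "additive_character \<psi>"
begin

interpretation additive_character \<psi> by (rule psi)

text \<open>In the notation of the overview, \<open>G1\<close> is X + i Y, \<open>G2\<close> is g,
  and \<open>eta a\<close> is the quartic Gauss period of the coset of \<open>a\<close> when
  \<open>a\<close> is nonzero.\<close>

definition "G1 = gauss_sum \<rho> \<psi>"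
definition "G2 = gauss_sum (\<lambda>x. \<rho> x * \<rho> x) \<psi>"
definition "eta a = (\<Sum>r\<in>{x. x ^ n = 1}. \<psi> (a * r))"

lemma G1_norm: "(Re G1)\<^sup>2 + (Im G1)\<^sup>2 = of_nat (4 * n + 1)"
proof -
  obtain z where "z \<noteq> 0" "\<rho> z \<noteq> 1" using square_nontrivial by metis
  then have "G1 * cnj G1 = of_nat CARD('a)"
    unfolding G1_def by (intro gauss_sum_norm multiplicative_character_axioms psi)
  then have "complex_of_real ((Re G1)\<^sup>2 + (Im G1)\<^sup>2) = complex_of_real (of_nat (4 * n + 1))"
    by (simp only: complex_mult_cnj card of_real_of_nat_eq)
  then show ?thesis by (simp only: of_real_eq_iff)
qed

text \<open>The square of \<open>\<rho>\<close> takes real values and is even, so conjugation merely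
  replaces \<open>x\<close> by \<open>- x\<close> in the sum.\<close>

lemma G2_real: "Im G2 = 0"
proof -
  have "cnj G2 = (\<Sum>x\<in>UNIV. cnj (\<rho> x * \<rho> x) * \<psi> (- x))"
    by (simp add: G2_def gauss_sum_def uminus)
  also have "\<dots> = (\<Sum>x\<in>UNIV. \<rho> x * \<rho> x * \<psi> (- x))"
  proof (intro sum.cong refl)
    fix x show "cnj (\<rho> x * \<rho> x) * \<psi> (- x) = \<rho> x * \<rho> x * \<psi> (- x)"
      by (cases "x = 0") (auto simp: \<rho>_def elim: power_n_cases)
  qed
  also have "\<dots> = G2"
    unfolding G2_def gauss_sum_def by (rule sum.reindex_bij_witness[of _ uminus uminus]) auto
  finally show ?thesis by (simp add: complex_eq_iff)
qed

lemma G2_square: "(Re G2)\<^sup>2 = of_nat (4 * n + 1)"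
proof -
  obtain z where "z \<noteq> 0" "\<rho> z * \<rho> z \<noteq> 1" using square_nontrivial by metis
  then have "G2 * cnj G2 = of_nat CARD('a)"
    unfolding G2_def by (intro gauss_sum_norm multiplicative_character_square psi)
  then have "complex_of_real ((Re G2)\<^sup>2 + (Im G2)\<^sup>2) = complex_of_real (of_nat (4 * n + 1))"
    by (simp only: complex_mult_cnj card of_real_of_nat_eq)
  then show ?thesis by (simp only: of_real_eq_iff G2_real) simp
qed

lemma G1_square: "G1 * G1 = jacobi_sum \<rho> \<rho> * G2"
proof -
  interpret S: multiplicative_character "\<lambda>x. \<rho> x * \<rho> x" by (rule multiplicative_character_square)
  obtain z where "z \<noteq> 0" "\<rho> z * \<rho> z \<noteq> 1" using square_nontrivial by metis
  then have "(\<Sum>x\<in>UNIV. \<rho> x * \<rho> x) = 0" by (rule S.sum_chi_eq_0)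
  then show ?thesis unfolding G1_def G2_def
    by (intro gauss_sum_mult multiplicative_character_axioms psi)
qed

text \<open>On nonzero elements, a quarter of the sum of the four powers of \<open>\<rho>\<close> is
  the indicator of the fourth powers. Each character then contributes a twisted Gauss sum.\<close>

lemma four_eta:
  assumes "a \<noteq> 0"
  shows "4 * eta a = - 1 + cnj (\<rho> a) * G1 + cnj (\<rho> a * \<rho> a) * G2 + \<rho> a * cnj G1"
proof -
  let ?f = "\<lambda>x. (1 + \<rho> x + \<rho> x * \<rho> x + cnj (\<rho> x))"
  have ind1: "?f x = 4" if "x ^ n = 1" for x using that by (simp add: \<rho>_def)
  have ind0: "?f x = 0" if "x \<noteq> 0" "x ^ n \<noteq> 1" for x
    using that by (elim power_n_cases) (simp_all add: \<rho>_def)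
  have "4 * eta a = (\<Sum>x\<in>{x. x ^ n = 1}. ?f x * \<psi> (a * x))"
    unfolding eta_def sum_distrib_left by (intro sum.cong refl) (simp only: ind1 mem_Collect_eq)
  also have "\<dots> = (\<Sum>x\<in>UNIV - {0}. ?f x * \<psi> (a * x))"
  proof (rule sum.mono_neutral_left)
    show "\<forall>x\<in>UNIV - {0} - {x. x ^ n = 1}. ?f x * \<psi> (a * x) = 0"
    proof
      fix x :: 'a assume "x \<in> UNIV - {0} - {x. x ^ n = 1}"
      then have "?f x = 0" by (intro ind0) auto
      then show "?f x * \<psi> (a * x) = 0" by (simp only: mult_zero_left)
    qed
  qed auto
  \<comment> \<open>The correction is the term at \<open>x = 0\<close>, where only the constant
    summand 1 of \<open>?f\<close> survives.\<close>
  also have "\<dots> = (\<Sum>x\<in>UNIV. ?f x * \<psi> (a * x)) - 1"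
    by (subst sum_diff1) auto
  also have "(\<Sum>x\<in>UNIV. ?f x * \<psi> (a * x)) = (\<Sum>x\<in>UNIV. \<psi> (a * x)) + (\<Sum>x\<in>UNIV. \<rho> x * \<psi> (a * x))
      + (\<Sum>x\<in>UNIV. (\<rho> x * \<rho> x) * \<psi> (a * x)) + (\<Sum>x\<in>UNIV. cnj (\<rho> x) * \<psi> (a * x))"
    by (simp add: distrib_right sum.distrib)
  also have "(\<Sum>x\<in>UNIV. \<psi> (a * x)) = 0" using sum_eq assms by simp
  also have "(\<Sum>x\<in>UNIV. \<rho> x * \<psi> (a * x)) = cnj (\<rho> a) * G1"
    unfolding G1_def by (intro gauss_sum_twist multiplicative_character_axioms assms)
  also have "(\<Sum>x\<in>UNIV. (\<rho> x * \<rho> x) * \<psi> (a * x)) = cnj (\<rho> a * \<rho> a) * G2"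
    unfolding G2_def by (intro gauss_sum_twist multiplicative_character_square assms)
  also have "(\<Sum>x\<in>UNIV. cnj (\<rho> x) * \<psi> (a * x)) = cnj (\<Sum>x\<in>UNIV. \<rho> x * \<psi> (a * x))"
    unfolding cnj_sum
    by (rule sum.reindex_bij_witness[of _ uminus uminus]) (auto simp: uminus)
  also have "(\<Sum>x\<in>UNIV. \<rho> x * \<psi> (a * x)) = cnj (\<rho> a) * G1"
    unfolding G1_def by (intro gauss_sum_twist multiplicative_character_axioms assms)
  finally show ?thesis by simp
qed

lemma eta_values:
  shows "a ^ n = 1 \<Longrightarrow> 4 * eta a = of_real (- 1 + Re G2 + 2 * Re G1)"
    and "a ^ n = h \<Longrightarrow> 4 * eta a = of_real (- 1 - Re G2 + 2 * Im G1)"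
    and "a ^ n = - 1 \<Longrightarrow> 4 * eta a = of_real (- 1 + Re G2 - 2 * Re G1)"
    and "a ^ n = - h \<Longrightarrow> 4 * eta a = of_real (- 1 - Re G2 - 2 * Im G1)"
proof -
  have a0: "a \<noteq> 0" if "a ^ n \<noteq> 0" using that n_pos by auto
  show "4 * eta a = of_real (- 1 + Re G2 + 2 * Re G1)" if "a ^ n = 1"
    using four_eta[of a] a0 that by (simp add: \<rho>_values complex_eq_iff G2_real)
  show "4 * eta a = of_real (- 1 - Re G2 + 2 * Im G1)" if "a ^ n = h"
    using four_eta[of a] a0 that by (simp add: \<rho>_values complex_eq_iff G2_real)
  show "4 * eta a = of_real (- 1 + Re G2 - 2 * Re G1)" if "a ^ n = - 1"
    using four_eta[of a] a0 that by (simp add: \<rho>_values complex_eq_iff G2_real)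
  show "4 * eta a = of_real (- 1 - Re G2 - 2 * Im G1)" if "a ^ n = - h"
    using four_eta[of a] a0 that by (simp add: \<rho>_values complex_eq_iff G2_real)
qed

text \<open>The fourth powers form a union of cosets of the multiplicative group of the prime field, and the
  sum of \<open>\<psi>\<close> over such a coset is \<open>- 1\<close> or \<open>p - 1\<close>.\<close>

lemma eta_Ints:
  assumes p: "prime p" and card_p: "CARD('a) = p ^ m" and dvd: "(p - 1) dvd n"
  shows "eta a \<in> \<int>"
proof -
  have ch: "CHAR('a) = p" using card_p p by (rule CHAR_eq_of_CARD_eq_prime_power)
  have p1: "p > 1" using p prime_gt_1_nat by auto
  \<comment> \<open>\<open>F\<close> is the multiplicative group of the prime field.\<close>
  define F where "F = {x::'a. x ^ (p - 1) = 1}"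
  have F: "insert 0 F = of_nat ` {..<p}"
  proof -
    have "x ^ p = x * x ^ (p - 1)" for x :: 'a using p1 by (subst power_Suc[symmetric]) simp
    then have "insert 0 F = {x. x ^ p = x}" using p1 by (auto simp: F_def)
    then show ?thesis using of_nat_image_roots(2)[OF ch p] by simp
  qed
  have F0: "0 \<notin> F" using p1 by (simp add: F_def power_0_left)
  have orbit: "(\<Sum>x\<in>F. \<psi> (x * y)) \<in> \<int>" for y
  proof -
    \<comment> \<open>Adjoining 0 turns the orbit sum into a full geometric sum of powers of a
      \<open>p\<close>-th root of unity, equal to \<open>p\<close> or 0.\<close>
    have "(\<Sum>x\<in>insert 0 F. \<psi> (x * y)) = (\<Sum>k<p. \<psi> (of_nat k * y))"
      unfolding F by (subst sum.reindex) (use of_nat_image_roots(1)[OF ch p] in auto)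
    also have "\<dots> = (\<Sum>k<p. \<psi> y ^ k)" by (simp add: of_nat_mult)
    also have "\<dots> \<in> \<int>"
    proof (cases "\<psi> y = 1")
      case False
      have "\<psi> y ^ p = 1" using of_nat_mult[of p y] ch by (metis mult_zero_left of_nat_CHAR zero)
      then show ?thesis using geometric_sum[OF False, of p] by simp
    qed simp
    finally have "1 + (\<Sum>x\<in>F. \<psi> (x * y)) \<in> \<int>" using F0 by simp
    then show ?thesis by (metis Ints_1 Ints_diff add_diff_cancel_left')
  qed
  define R where "R = {x::'a. x ^ n = 1}"
  define orb where "orb y = (\<lambda>x. x * y) ` F" for y
  \<comment> \<open>This is where divisibility of \<open>n\<close> by \<open>p - 1\<close>
    enters.\<close>
  have "F \<subseteq> R" unfolding F_def R_def using dvd by (auto elim!: dvdE simp: power_mult)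
  then have orb_R: "orb y \<subseteq> R" if "y \<in> R" for y
    using that by (auto simp: orb_def R_def power_mult_distrib)
  have self: "y \<in> orb y" for y by (auto simp: orb_def F_def intro!: image_eqI[of _ _ 1])
  have disj: "orb y = orb z" if "orb y \<inter> orb z \<noteq> {}" "y \<in> R" "z \<in> R" for y z
  proof -
    have *: "orb y \<subseteq> orb z" if yz: "orb y \<inter> orb z \<noteq> {}" "y \<in> R" "z \<in> R" for y z
    proof -
      obtain u v where uv: "u \<in> F" "v \<in> F" "u * y = v * z" using yz by (auto simp: orb_def)
      then have u0: "u \<noteq> 0" using F0 by auto
      have "w * y \<in> orb z" if "w \<in> F" for w
      proof -
        have "w * y = (w * inverse u * v) * z" using u0 uv(3) by (metis mult.assoc mult.left_commute right_inverse mult.commute mult_1)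
        moreover have "w * inverse u * v \<in> F"
          using that uv by (simp add: F_def power_mult_distrib power_inverse)
        ultimately show ?thesis unfolding orb_def by (rule image_eqI[where f = "\<lambda>x. x * z"])
      qed
      then show ?thesis by (auto simp: orb_def)
    qed
    show ?thesis using *[OF that] *[of z y] that by blast
  qed
  have "eta a = (\<Sum>r\<in>\<Union>(orb ` R). \<psi> (a * r))"
    unfolding eta_def R_def[symmetric] using orb_R self by (intro sum.cong) auto
  also have "\<dots> = (\<Sum>c\<in>orb ` R. \<Sum>r\<in>c. \<psi> (a * r))"
    by (subst sum.Union_disjoint) (use disj in \<open>auto simp: disjnt_def\<close>)
  also have "\<dots> \<in> \<int>"
  proof (rule Ints_sum)
    fix c assume "c \<in> orb ` R"
    then obtain y where y: "y \<in> R" "c = orb y" by blast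
    then have "y \<noteq> 0" by (auto simp: R_def)
    then have "(\<Sum>r\<in>c. \<psi> (a * r)) = (\<Sum>x\<in>F. \<psi> (a * (x * y)))"
      unfolding y(2) orb_def by (subst sum.reindex) (auto simp: inj_on_def)
    also have "\<dots> = (\<Sum>x\<in>F. \<psi> (x * (a * y)))" by (simp add: mult_ac)
    finally show "(\<Sum>r\<in>c. \<psi> (a * r)) \<in> \<int>" using orbit by simp
  qed
  finally show ?thesis .
qed

end

text \<open>Reduction of \<open>\<int>[\<i>]\<close> at the prime with \<open>\<i> \<mapsto> - h\<close>, which turns \<open>\<rho> x\<close> into \<open>x\<^sup>3\<^sup>n\<close>.\<close>

lemma jacobi_sum_reduction:
  "\<exists>A B :: int. jacobi_sum \<rho> \<rho> = of_int A + \<i> * of_int B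
     \<and> of_int A - h * of_int B = - of_nat ((3 * n) choose n)"
proof -
  \<comment> \<open>\<open>red z w\<close> states that the Gaussian integer \<open>z\<close> reduces
    to \<open>w\<close>; it is kept as a relation carrying the coordinates, which the conclusion
    asks for.\<close>
  define red where "red z w \<longleftrightarrow> (\<exists>A B :: int. z = of_int A + \<i> * of_int B \<and> w = of_int A - h * of_int B)" for z w
  have red_add: "red (z + z') (w + w')" if "red z w" "red z' w'" for z z' w w'
  proof -
    obtain A B C D where zw: "z = of_int A + \<i> * of_int B" "w = of_int A - h * of_int B"
      "z' = of_int C + \<i> * of_int D" "w' = of_int C - h * of_int D"
      using \<open>red z w\<close> \<open>red z' w'\<close> unfolding red_def by blast
    show ?thesis unfolding red_def zw
      by (rule exI[of _ "A + C"], rule exI[of _ "B + D"], simp add: algebra_simps)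
  qed
  have red_mult: "red (z * z') (w * w')" if "red z w" "red z' w'" for z z' w w'
  proof -
    obtain A B C D where zw: "z = of_int A + \<i> * of_int B" "w = of_int A - h * of_int B"
      "z' = of_int C + \<i> * of_int D" "w' = of_int C - h * of_int D"
      using \<open>red z w\<close> \<open>red z' w'\<close> unfolding red_def by blast
    have "w * w' = of_int A * of_int C + h * h * (of_int B * of_int D) - h * (of_int A * of_int D + of_int B * of_int C)"
      unfolding zw by (simp add: algebra_simps)
    then have "w * w' = of_int (A * C - B * D) - h * of_int (A * D + B * C)" by (simp add: h)
    moreover have "z * z' = of_int (A * C - B * D) + \<i> * of_int (A * D + B * C)"
      unfolding zw by (simp add: complex_eq_iff algebra_simps)
    ultimately show ?thesis unfolding red_def by blast
  qed
  have red_rho: "red (\<rho> x) (x ^ (3 * n))" for x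
  proof (cases "x = 0")
    case False
    have pw: "x ^ (3 * n) = x ^ n * x ^ n * x ^ n" by (simp add: mult.commute power_mult power3_eq_cube)
    show ?thesis using False
    proof (cases rule: power_n_cases)
      case 1 then show ?thesis unfolding pw red_def by - (rule exI[of _ 1], rule exI[of _ 0], simp add: \<rho>_values)
    next
      case 2 then show ?thesis unfolding pw red_def by - (rule exI[of _ 0], rule exI[of _ 1], simp add: \<rho>_values h)
    next
      case 3 then show ?thesis unfolding pw red_def by - (rule exI[of _ "-1"], rule exI[of _ 0], simp add: \<rho>_values)
    next
      case 4 then show ?thesis unfolding pw red_def by - (rule exI[of _ 0], rule exI[of _ "-1"], simp add: \<rho>_values h)
    qed
  qed (use n_pos in \<open>auto simp: red_def intro!: exI[of _ 0]\<close>)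
  have red_sum: "red (\<Sum>x\<in>S. f x) (\<Sum>x\<in>S. g x)" if "finite S" "\<And>x. red (f x) (g x)" for S :: "'a set" and f g
    using that(1)
  proof (induction S rule: finite_induct)
    case empty
    show ?case unfolding red_def by (rule exI[of _ 0], rule exI[of _ 0]) simp
  next
    case (insert x S)
    then show ?case using red_add that(2) by simp
  qed
  have "red (jacobi_sum \<rho> \<rho>) (\<Sum>x\<in>UNIV. x ^ (3 * n) * (1 - x) ^ (3 * n))"
    unfolding jacobi_sum_def by (intro red_sum red_mult red_rho) simp
  moreover have "(\<Sum>x\<in>UNIV. (x::'a) ^ (3 * n) * (1 - x) ^ (3 * n)) = - of_nat ((3 * n) choose n)"
  proof -
    have "x ^ (3 * n) * (1 - x) ^ (3 * n)
        = (\<Sum>j\<le>3 * n. of_nat ((3 * n) choose j) * (- 1) ^ j * x ^ (3 * n + j))" for x :: 'a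
    proof -
      have "(1 - x) ^ (3 * n) = (- x + 1) ^ (3 * n)" by simp
      also have "\<dots> = (\<Sum>j\<le>3 * n. of_nat ((3 * n) choose j) * (- x) ^ j * 1 ^ (3 * n - j))"
        by (rule binomial_ring)
      finally show ?thesis
        by (simp add: sum_distrib_left power_add power_minus[of x] mult_ac)
    qed
    then have "(\<Sum>x\<in>UNIV. (x::'a) ^ (3 * n) * (1 - x) ^ (3 * n))
        = (\<Sum>x\<in>UNIV. \<Sum>j\<le>3 * n. of_nat ((3 * n) choose j) * (- 1) ^ j * (x::'a) ^ (3 * n + j))"
      by (simp only:)
    also have "\<dots> = (\<Sum>j\<le>3 * n. of_nat ((3 * n) choose j) * (- 1) ^ j * (\<Sum>x\<in>UNIV. (x::'a) ^ (3 * n + j)))"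
      by (subst sum.swap) (simp add: sum_distrib_left)
    also have "\<dots> = (\<Sum>j\<le>3 * n. if j = n then - of_nat ((3 * n) choose n) else 0)"
    proof (intro sum.cong refl)
      fix j assume j: "j \<in> {..3 * n}"
      \<comment> \<open>The power sum survives only for exponents divisible by
        \<open>CARD('a) - 1\<close>. Between \<open>3 * n\<close> and \<open>6 * n\<close> the only
        such exponent is \<open>4 * n\<close>.\<close>
      have "4 * n dvd 3 * n + j \<longleftrightarrow> j = n"
      proof
        assume "4 * n dvd 3 * n + j"
        then obtain l where l: "3 * n + j = 4 * n * l" by (elim dvdE)
        have "l = 1"
        proof (rule ccontr)
          assume "l \<noteq> 1"
          then consider "l = 0" | "l \<ge> 2" by linarith
          then show False
          proof cases
            case 2
            then have "4 * n * 2 \<le> 3 * n + j" unfolding l by (intro mult_le_mono2)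
            then show False using j n_pos by simp
          qed (use l n_pos in simp)
        qed
        then show "j = n" using l by simp
      qed simp
      then show "of_nat ((3 * n) choose j) * (- 1) ^ j * (\<Sum>x\<in>UNIV. (x::'a) ^ (3 * n + j))
          = (if j = n then - of_nat ((3 * n) choose n) else 0)"
        using sum_power_finite_field[of "3 * n + j", where 'a = 'a] n_pos n_even card by simp
    qed
    also have "\<dots> = - of_nat ((3 * n) choose n)" by simp
    finally show ?thesis .
  qed
  ultimately show ?thesis unfolding red_def by metis
qed

text \<open>For \<open>p \<equiv> 3 (mod 4)\<close> the Frobenius automorphism turns \<open>\<rho>\<close> into its conjugate.\<close>

lemma jacobi_sum_real:
  assumes "CHAR('a) = p" "prime p" "p mod 4 = 3"
  shows "Im (jacobi_sum \<rho> \<rho>) = 0"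
proof -
  have inj: "inj (\<lambda>x::'a. x ^ p)"
  proof (rule injI)
    fix x y :: 'a assume "x ^ p = y ^ p"
    moreover have "((x - y) + y) ^ p = (x - y) ^ p + y ^ p" by (rule freshmans_dream) (use assms in auto)
    ultimately show "x = y" by simp
  qed
  then have bij: "bij (\<lambda>x::'a. x ^ p)" by (simp add: bij_def finite_UNIV_inj_surj)
  have rho_p: "\<rho> (x ^ p) = cnj (\<rho> x)" for x
  proof -
    have i: "\<i> ^ p = - \<i>"
    proof -
      have "\<i> ^ p = \<i> ^ (4 * (p div 4) + 3)" using assms(3) by (metis mult_div_mod_eq)
      also have "\<dots> = - \<i>" by (simp add: power_add power_mult power3_eq_cube)
      finally show ?thesis .
    qed
    have "odd p" using assms(3) by presburger
    then have m: "(- 1 :: complex) ^ p = - 1" "(- \<i>) ^ p = \<i>" by (simp_all add: power_minus_odd i)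
    show ?thesis
    proof (cases "x = 0")
      case False
      then show ?thesis by (cases rule: power_n_cases) (simp_all add: chi_power \<rho>_values i m)
    qed (use assms prime_gt_0_nat in \<open>simp add: power_0_left\<close>)
  qed
  \<comment> \<open>Frobenius is bijective and commutes with \<open>x \<mapsto> 1 - x\<close>, so
    substituting it conjugates every factor.\<close>
  have "jacobi_sum \<rho> \<rho> = (\<Sum>x\<in>UNIV. \<rho> (x ^ p) * \<rho> (1 - x ^ p))"
    unfolding jacobi_sum_def using bij by (rule sum.reindex_bij_betw[symmetric])
  also have "\<dots> = (\<Sum>x\<in>UNIV. \<rho> (x ^ p) * \<rho> ((1 - x) ^ p))"
  proof (intro sum.cong refl)
    fix x :: 'a
    have "((1 - x) + x) ^ p = (1 - x) ^ p + x ^ p" by (rule freshmans_dream) (use assms in auto)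
    then have "(1 - x) ^ p = 1 - x ^ p" by (simp add: eq_diff_eq)
    then show "\<rho> (x ^ p) * \<rho> (1 - x ^ p) = \<rho> (x ^ p) * \<rho> ((1 - x) ^ p)" by simp
  qed
  also have "\<dots> = cnj (jacobi_sum \<rho> \<rho>)" by (simp add: rho_p jacobi_sum_def)
  finally show ?thesis by (simp add: complex_eq_iff)
qed

end

text \<open>By counting roots, some nonzero \<open>x\<close> has
  \<open>x ^ (2 * n) \<noteq> 1\<close>. The square of this power is 1, so it equals -1, and
  \<open>x ^ n\<close> serves as \<open>h\<close>.\<close>

lemma quartic_field_exists:
  assumes card: "CARD('a::{field,finite}) = 4 * n + 1" and n: "n > 0" "even n"
  shows "\<exists>h::'a. quartic_field h n"
proof -
  have one_neq: "(1::'a) \<noteq> - 1"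
  proof
    assume "(1::'a) = - 1"
    then have "(1::'a) + 1 = 0" by (simp add: eq_neg_iff_add_eq_0)
    then have "of_nat 2 = (0::'a)" by simp
    then have "CHAR('a) dvd 2" by (simp only: of_nat_eq_0_iff_char_dvd)
    moreover have "CHAR('a) dvd 2 * (2 * n) + 1" using CHAR_dvd_CARD[where 'a='a] card by simp
    ultimately have "CHAR('a) dvd 1" by (metis dvd_add_right_iff dvd_mult2)
    then show False by simp
  qed
  have "card {x::'a. x ^ (2 * n) = 1} \<le> 2 * n" using n by (intro card_power_eq_le) simp
  also have "\<dots> < card (UNIV - {0::'a})" using card n by simp
  finally have "\<not> UNIV - {0} \<subseteq> {x::'a. x ^ (2 * n) = 1}" using card_mono[OF finite] leD by blast
  then obtain x :: 'a where x: "x \<noteq> 0" "x ^ (2 * n) \<noteq> 1" by auto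
  have "2 * n + 2 * n = CARD('a) - 1" using card by simp
  then have "x ^ (2 * n) * x ^ (2 * n) = 1"
    using power_CARD_minus_1[OF x(1)] by (simp only: flip: power_add)
  then have "x ^ (2 * n) = 1 \<or> x ^ (2 * n) = - 1" by (simp only: square_eq_1_iff)
  then have "x ^ n * x ^ n = - 1" using x by (simp add: mult_2 flip: power_add)
  then show ?thesis using assms one_neq by (intro exI[of _ "x ^ n"]) (simp add: quartic_field_def)
qed

text \<open>Comparing \<open>f a\<close> with \<open>f (- a)\<close> selects one element from each
  pair \<open>{a, - a}\<close>. Negation exchanges the two halves of \<open>S\<close>, so both signs
  occur equally often.\<close>

lemma image_mset_signs:
  fixes f :: "'a::{group_add,finite} \<Rightarrow> nat"
  assumes f: "inj f" and sym: "\<And>a. a \<in> S \<Longrightarrow> - a \<in> S" "\<And>a. a \<in> S \<Longrightarrow> a \<noteq> - a"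
    and d: "\<And>a. a \<in> S \<Longrightarrow> d a = (if f a < f (- a) then complex_of_real e else - complex_of_real e)"
  shows "image_mset d (mset_set S) = image_mset complex_of_real (pm_mset (card S div 2) e)"
proof -
  define P N where "P = {a\<in>S. f a < f (- a)}" and "N = {a\<in>S. f (- a) < f a}"
  have "f a \<noteq> f (- a)" if "a \<in> S" for a using sym(2)[OF that] f by (simp add: inj_eq)
  then have S: "S = P \<union> N" unfolding P_def N_def by (auto intro: linorder_neqE_nat)
  have disj: "P \<inter> N = {}" by (auto simp: P_def N_def)
  have "bij_betw uminus P N"
    by (rule bij_betwI[of _ _ _ uminus]) (use sym in \<open>auto simp: P_def N_def\<close>)
  then have "card P = card N" by (rule bij_betw_same_card)
  moreover have "card S = card P + card N" unfolding S by (rule card_Un_disjoint) (use disj in auto)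
  ultimately have card: "card P = card S div 2" "card N = card S div 2" by simp_all
  have "image_mset d (mset_set P) = image_mset (\<lambda>_. complex_of_real e) (mset_set P)"
    by (rule image_mset_cong) (use d in \<open>auto simp: P_def\<close>)
  moreover have "image_mset d (mset_set N) = image_mset (\<lambda>_. - complex_of_real e) (mset_set N)"
    by (rule image_mset_cong) (use d in \<open>auto simp: N_def\<close>)
  moreover have "mset_set S = mset_set P + mset_set N"
    unfolding S by (rule mset_set_Union) (use disj in auto)
  ultimately show ?thesis by (simp add: card image_mset_const_eq pm_mset_def)
qed

section \<open>The spectrum in terms of the quartic periods\<close>

context quartic_field
begin

lemma paley_sum_graph_4:
  "(paley_sum_graph 4 :: 'a pair_pre_digraph) = \<lparr>pverts = UNIV, parcs = {(v, w). v + w \<in> {x. x ^ n = 1}}\<rparr>"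
  unfolding paley_sum_graph_def kth_powers_4 ..

text \<open>Frequency 0 gives the degree \<open>n\<close>. The other frequencies fall into the four
  fibres of \<open>x ^ n\<close>; each is closed under negation since \<open>n\<close> is even, and
  the period is constant on it.\<close>

lemma graph_spectrum_eta:
  assumes psi: "additive_character \<psi>"
    and e: "\<And>a. a ^ n = 1 \<Longrightarrow> eta \<psi> a = complex_of_real e0" "\<And>a. a ^ n = h \<Longrightarrow> eta \<psi> a = complex_of_real e1"
      "\<And>a. a ^ n = - 1 \<Longrightarrow> eta \<psi> a = complex_of_real e2" "\<And>a. a ^ n = - h \<Longrightarrow> eta \<psi> a = complex_of_real e3"
  shows "graph_spectrum (paley_sum_graph 4 :: 'a pair_pre_digraph) = image_mset complex_of_real
    ({#real n#} + pm_mset (n div 2) e0 + pm_mset (n div 2) e1 + pm_mset (n div 2) e2 + pm_mset (n div 2) e3)"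
proof -
  obtain f :: "'a \<Rightarrow> nat" where f: "inj f"
    using finite_imp_inj_to_nat_seg[of "UNIV :: 'a set"] by auto
  define \<sigma> :: "'a \<Rightarrow> complex" where "\<sigma> a = (if a = 0 then 0 else if f a < f (- a) then 1 else - 1)" for a
  have neg: "a \<noteq> - a" if "a \<noteq> 0" for a :: 'a
  proof
    assume "a = - a"
    then have "1 * a = (- 1) * a" by simp
    then show False using that one_neq by (metis mult_right_cancel)
  qed
  define d where "d a = (if a = 0 then of_nat (card {x::'a. x ^ n = 1}) else \<sigma> a * (\<Sum>r\<in>{x. x ^ n = 1}. \<psi> (a * r)))" for a
  have spec: "graph_spectrum (paley_sum_graph 4 :: 'a pair_pre_digraph) = image_mset d (mset_set UNIV)"
    unfolding paley_sum_graph_4 d_def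
  proof (rule cayley_sum_spectrum[OF psi])
    show "- r \<in> {x. x ^ n = 1}" if "r \<in> {x. x ^ n = 1}" for r :: 'a
      using that n_even by simp
    show "\<sigma> (- a) = - \<sigma> a" for a
    proof (cases "a = 0")
      case False
      then have "f a \<noteq> f (- a)" using neg f by (simp add: inj_eq)
      then show ?thesis using False by (simp add: \<sigma>_def)
    qed (simp add: \<sigma>_def)
  qed (auto simp: \<sigma>_def)
  let ?C = "\<lambda>c::'a. {x. x ^ n = c}"
  have U: "UNIV = {0} \<union> (?C 1 \<union> (?C h \<union> (?C (- 1) \<union> ?C (- h))))"
  proof (intro set_eqI iffI)
    fix x :: 'a
    show "x \<in> {0} \<union> (?C 1 \<union> (?C h \<union> (?C (- 1) \<union> ?C (- h))))"
    proof (cases "x = 0")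
      case False
      then show ?thesis by (cases rule: power_n_cases) simp_all
    qed simp
  qed simp
  have "mset_set (UNIV :: 'a set) = mset_set {0} + (mset_set (?C 1) + (mset_set (?C h) + (mset_set (?C (- 1)) + mset_set (?C (- h)))))"
  proof -
    have un: "mset_set (A \<union> B) = mset_set A + mset_set B" if "A \<inter> B = {}" for A B :: "'a set"
      using that by (simp add: mset_set_Union)
    have "(2::'a) \<noteq> 0" using one_neq by (metis eq_neg_iff_add_eq_0 one_add_one)
    then have "?C (- 1) \<inter> ?C (- h) = {}" "?C h \<inter> (?C (- 1) \<union> ?C (- h)) = {}"
      "?C 1 \<inter> (?C h \<union> (?C (- 1) \<union> ?C (- h))) = {}" "{0} \<inter> (?C 1 \<union> (?C h \<union> (?C (- 1) \<union> ?C (- h)))) = {}"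
      by auto
    then show ?thesis by (subst U) (simp only: un)
  qed
  moreover have "image_mset d (mset_set (?C c)) = image_mset complex_of_real (pm_mset (n div 2) e)"
    if c: "c \<in> {1, h, - 1, - h}" and e: "\<And>a. a ^ n = c \<Longrightarrow> eta \<psi> a = complex_of_real e" for c e
  proof -
    have nz: "a \<noteq> 0" if "a ^ n = c" for a using that c by auto
    have "image_mset d (mset_set (?C c)) = image_mset complex_of_real (pm_mset (card (?C c) div 2) e)"
    proof (rule image_mset_signs[OF f])
      show "- a \<in> ?C c" if "a \<in> ?C c" for a using that n_even by simp
      show "a \<noteq> - a" if "a \<in> ?C c" for a using neg[OF nz[of a]] that by blast
      show "d a = (if f a < f (- a) then complex_of_real e else - complex_of_real e)" if "a \<in> ?C c" for a
        using that nz[of a] e[of a] by (simp add: d_def \<sigma>_def eta_def[OF psi])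
    qed
    then show ?thesis using card_fibre[OF c] by simp
  qed
  from this[OF _ e(1)] this[OF _ e(2)] this[OF _ e(3)] this[OF _ e(4)]
  have "image_mset d (mset_set (?C 1)) = image_mset complex_of_real (pm_mset (n div 2) e0)"
    "image_mset d (mset_set (?C h)) = image_mset complex_of_real (pm_mset (n div 2) e1)"
    "image_mset d (mset_set (?C (- 1))) = image_mset complex_of_real (pm_mset (n div 2) e2)"
    "image_mset d (mset_set (?C (- h))) = image_mset complex_of_real (pm_mset (n div 2) e3)"
    by blast+
  moreover have "d 0 = complex_of_real (real n)" using card_fibre[of 1] by (simp add: d_def)
  ultimately show ?thesis unfolding spec by simp
qed

text \<open>Translates the character theory into integer data: \<open>g\<close> is the Gauss sum of
  the squared character, \<open>X\<close> and \<open>Y\<close> are the coordinates of the quartic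
  Gauss sum, and \<open>A\<close> and \<open>B\<close> are those of the Jacobi sum. The remaining
  case analysis is pure integer arithmetic.\<close>

lemma graph_spectrum_integers:
  assumes p: "prime p" and card_p: "CARD('a) = p ^ m" and dvd: "(p - 1) dvd n"
  obtains g X Y A B :: int where
    "graph_spectrum (paley_sum_graph 4 :: 'a pair_pre_digraph) = image_mset complex_of_real
      ({#real n#} + (\<Sum>z\<in>#{#- 1 + g + 2 * X, - 1 - g + 2 * Y, - 1 + g - 2 * X, - 1 - g - 2 * Y#}.
         pm_mset (n div 2) (of_int z / 4)))"
    and "\<forall>z\<in>{- 1 + g + 2 * X, - 1 - g + 2 * Y, - 1 + g - 2 * X, - 1 - g - 2 * Y}. 4 dvd z"
    and "g\<^sup>2 = int (p ^ m)" and "X\<^sup>2 + Y\<^sup>2 = int (p ^ m)"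
    and "X\<^sup>2 - Y\<^sup>2 = g * A" and "2 * X * Y = g * B"
    and "p mod 4 = 3 \<longrightarrow> B = 0"
    and "p mod 4 = 1 \<longrightarrow> \<not> (int p dvd A \<and> int p dvd B)"
proof -
  obtain \<psi> :: "'a \<Rightarrow> complex" where psi: "additive_character \<psi>"
    using additive_character_exists[OF card_p p] by blast
  have ch: "CHAR('a) = p" using card_p p by (rule CHAR_eq_of_CARD_eq_prime_power)
  let ?G1 = "G1 \<psi>" and ?G2 = "G2 \<psi>"
  have val: "\<exists>z::int. \<forall>a. a ^ n = c \<longrightarrow> eta \<psi> a = of_int z" if c: "c \<in> {1, h, - 1, - h}" for c
  proof -
    have "{x. x ^ n = c} \<noteq> {}" using card_fibre[OF c] n_pos by force
    then obtain a where a: "a ^ n = c" by blast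
    obtain z where z: "eta \<psi> a = of_int z" using eta_Ints[OF psi p card_p dvd, of a] by (elim Ints_cases)
    obtain r where r: "\<And>b. b ^ n = c \<Longrightarrow> 4 * eta \<psi> b = complex_of_real r"
      using c eta_values[OF psi] by blast
    have "eta \<psi> b = of_int z" if b: "b ^ n = c" for b
    proof -
      have "4 * eta \<psi> b = 4 * eta \<psi> a" using r[OF a] r[OF b] by simp
      then show ?thesis using z by simp
    qed
    then show ?thesis by blast
  qed
  obtain z0 z1 z2 z3 :: int where z: "\<And>a. a ^ n = 1 \<Longrightarrow> eta \<psi> a = of_int z0"
    "\<And>a. a ^ n = h \<Longrightarrow> eta \<psi> a = of_int z1" "\<And>a. a ^ n = - 1 \<Longrightarrow> eta \<psi> a = of_int z2"
    "\<And>a. a ^ n = - h \<Longrightarrow> eta \<psi> a = of_int z3"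
    using val[of 1] val[of h] val[of "- 1"] val[of "- h"] by auto
  have real: "4 * real_of_int z = r" if "c \<in> {1, h, - 1, - h}" "\<And>a. a ^ n = c \<Longrightarrow> eta \<psi> a = of_int z"
     "\<And>a. a ^ n = c \<Longrightarrow> 4 * eta \<psi> a = complex_of_real r" for c :: 'a and z r
  proof -
    have "{x. x ^ n = c} \<noteq> {}" using card_fibre[OF that(1)] n_pos by force
    then obtain a where "a ^ n = c" by blast
    then have "complex_of_real (4 * real_of_int z) = complex_of_real r" using that(2,3) by simp
    then show ?thesis by (simp only: of_real_eq_iff)
  qed
  have mem: "1 \<in> {1, h, - 1, - h}" "h \<in> {1, h, - 1, - h}" "- 1 \<in> {1, h, - 1, - h}" "- h \<in> {1, h, - 1, - h}"
    by simp_all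
  have r0: "4 * real_of_int z0 = - 1 + Re ?G2 + 2 * Re ?G1"
    by (rule real[OF mem(1) z(1) eta_values(1)[OF psi]])
  have r1: "4 * real_of_int z1 = - 1 - Re ?G2 + 2 * Im ?G1"
    by (rule real[OF mem(2) z(2) eta_values(2)[OF psi]])
  have r2: "4 * real_of_int z2 = - 1 + Re ?G2 - 2 * Re ?G1"
    by (rule real[OF mem(3) z(3) eta_values(3)[OF psi]])
  have r3: "4 * real_of_int z3 = - 1 - Re ?G2 - 2 * Im ?G1"
    by (rule real[OF mem(4) z(4) eta_values(4)[OF psi]])
  \<comment> \<open>Solving the four period formulas for the Gauss sums exhibits them as integer
    combinations of the periods; in particular \<open>g\<close> is odd.\<close>
  define g X Y where "g = 2 * (z0 + z2) + 1" and "X = z0 - z2" and "Y = z1 - z3"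
  have g: "Re ?G2 = of_int g" and X: "Re ?G1 = of_int X" and Y: "Im ?G1 = of_int Y"
    using r0 r1 r2 r3 by (simp_all add: g_def X_def Y_def)
  have zs: "4 * z0 = - 1 + g + 2 * X" "4 * z1 = - 1 - g + 2 * Y" "4 * z2 = - 1 + g - 2 * X" "4 * z3 = - 1 - g - 2 * Y"
    using r0 r1 r2 r3 unfolding g X Y by linarith+
  obtain A B where J: "jacobi_sum \<rho> \<rho> = of_int A + \<i> * of_int B"
    and red: "of_int A - h * of_int B = - of_nat ((3 * n) choose n)"
    using jacobi_sum_reduction by blast
  have q: "4 * n + 1 = p ^ m" using card card_p by simp
  show thesis
  proof (rule that[of g X Y A B])
    have "graph_spectrum (paley_sum_graph 4 :: 'a pair_pre_digraph) = image_mset complex_of_real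
      ({#real n#} + pm_mset (n div 2) (of_int z0) + pm_mset (n div 2) (of_int z1)
        + pm_mset (n div 2) (of_int z2) + pm_mset (n div 2) (of_int z3))"
      by (rule graph_spectrum_eta[OF psi]) (use z in auto)
    then show "graph_spectrum (paley_sum_graph 4 :: 'a pair_pre_digraph) = image_mset complex_of_real
      ({#real n#} + (\<Sum>z\<in>#{#- 1 + g + 2 * X, - 1 - g + 2 * Y, - 1 + g - 2 * X, - 1 - g - 2 * Y#}.
         pm_mset (n div 2) (of_int z / 4)))"
      unfolding zs[symmetric] by (simp add: add_ac)
    show "\<forall>z\<in>{- 1 + g + 2 * X, - 1 - g + 2 * Y, - 1 + g - 2 * X, - 1 - g - 2 * Y}. 4 dvd z"
      unfolding zs[symmetric] by simp
    have "real_of_int (g\<^sup>2) = real_of_int (int (p ^ m))"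
      using G2_square[OF psi] unfolding g q by simp
    then show "g\<^sup>2 = int (p ^ m)" by (simp only: of_int_eq_iff)
    have "real_of_int (X\<^sup>2 + Y\<^sup>2) = real_of_int (int (p ^ m))"
      using G1_norm[OF psi] unfolding X Y q by simp
    then show "X\<^sup>2 + Y\<^sup>2 = int (p ^ m)" by (simp only: of_int_eq_iff)
    have "?G2 = of_int g" using g G2_real[OF psi] by (simp add: complex_eq_iff)
    moreover have "?G1 = of_int X + \<i> * of_int Y" using X Y by (simp add: complex_eq_iff)
    ultimately have "(of_int X + \<i> * of_int Y) * (of_int X + \<i> * of_int Y) = (of_int A + \<i> * of_int B) * complex_of_int g"
      using G1_square[OF psi] J by simp
    then have "real_of_int (X\<^sup>2 - Y\<^sup>2) = real_of_int (g * A)" "real_of_int (2 * X * Y) = real_of_int (g * B)"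
      by (simp_all add: complex_eq_iff power2_eq_square mult_ac)
    then show "X\<^sup>2 - Y\<^sup>2 = g * A" "2 * X * Y = g * B" by (simp_all only: of_int_eq_iff)
    show "p mod 4 = 3 \<longrightarrow> B = 0"
      using jacobi_sum_real[OF ch p] J by simp
    show "p mod 4 = 1 \<longrightarrow> \<not> (int p dvd A \<and> int p dvd B)"
    proof (intro impI notI)
      assume p4: "p mod 4 = 1"
      assume "int p dvd A \<and> int p dvd B"
      \<comment> \<open>If both coordinates vanished in the field, the reduction of the Jacobi sum
        would force \<open>p\<close> to divide the binomial coefficient.\<close>
      then have "of_int A = (0::'a)" "of_int B = (0::'a)"
        using ch by (simp_all add: of_int_eq_0_iff_char_dvd)
      then have "of_nat ((3 * n) choose n) = (0::'a)" using red by simp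
      then have "p dvd ((3 * n) choose n)" using ch by (simp add: of_nat_eq_0_iff_char_dvd)
      moreover have "p = 4 * (p div 4) + 1" using p4 by presburger
      ultimately show False using not_dvd_binomial_quarter[OF p _ q[symmetric]] by blast
    qed
  qed
qed

end

section \<open>Determination of the periods\<close>

lemma pm_mset_uminus: "pm_mset k (- x) = pm_mset k x"
  by (simp add: pm_mset_def add.commute)

text \<open>Adding and subtracting the two divisible quantities gives twice the squares of
  \<open>X\<close> and \<open>Y\<close>, and 2 is prime to \<open>p\<close>.\<close>

lemma pow_dvd_components:
  fixes X Y :: int
  assumes "prime p" "odd p" "X\<^sup>2 + Y\<^sup>2 = int p ^ (4 * t)" "int p ^ (2 * t) dvd X\<^sup>2 - Y\<^sup>2"
  shows "int p ^ t dvd X" "int p ^ t dvd Y"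
proof -
  have "coprime (int p) 2" using assms(2) by simp
  then have cop: "coprime (int p ^ (2 * t)) 2" by simp
  have "int p ^ (2 * t) dvd X\<^sup>2 + Y\<^sup>2" unfolding assms(3) by (rule le_imp_power_dvd) simp
  then have "int p ^ (2 * t) dvd (X\<^sup>2 + Y\<^sup>2) + (X\<^sup>2 - Y\<^sup>2)" "int p ^ (2 * t) dvd (X\<^sup>2 + Y\<^sup>2) - (X\<^sup>2 - Y\<^sup>2)"
    using assms(4) by (rule dvd_add, rule dvd_diff)
  then have "int p ^ (2 * t) dvd 2 * X\<^sup>2" "int p ^ (2 * t) dvd 2 * Y\<^sup>2" by simp_all
  then have "int p ^ (2 * t) dvd X\<^sup>2" "int p ^ (2 * t) dvd Y\<^sup>2"
    using cop coprime_dvd_mult_right_iff by blast+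
  then have "(int p ^ t)\<^sup>2 dvd X\<^sup>2" "(int p ^ t)\<^sup>2 dvd Y\<^sup>2"
    by (simp_all add: mult.commute flip: power_mult)
  then show "int p ^ t dvd X" "int p ^ t dvd Y" by simp_all
qed

text \<open>Take \<open>d = b / 2\<close>, and let \<open>c\<close> be whichever of \<open>a\<close>
  and \<open>- a\<close> is 1 modulo 4; changing the sign only permutes the multiset.\<close>

lemma quartic_pair_from_parity:
  fixes a b :: int
  assumes p: "prime p" and ab: "a\<^sup>2 + b\<^sup>2 = Q" "\<not> int p dvd a" "odd a" "even b"
  shows "\<exists>c d. c\<^sup>2 + 4 * d\<^sup>2 = Q \<and> [c = 1] (mod 4) \<and> coprime c (int p) \<and>
    {#- 1 - Q + 2 * P * a, - 1 + Q + 2 * P * b, - 1 - Q - 2 * P * a, - 1 + Q - 2 * P * b#}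
    = {#Q + 4 * d * P - 1, Q - 4 * d * P - 1, - Q + 2 * c * P - 1, - Q - 2 * c * P - 1#}"
proof -
  obtain d where d: "b = 2 * d" using ab by (elim evenE)
  define c where "c = (if a mod 4 = 1 then a else - a)"
  have "a mod 4 = 1 \<or> a mod 4 = 3" using \<open>odd a\<close> by presburger
  then have "[c = 1] (mod 4)" unfolding c_def cong_def by presburger
  moreover have "coprime c (int p)"
    using p ab(2) prime_imp_coprime[of "int p" c] by (simp add: c_def coprime_commute split: if_splits)
  moreover have "c\<^sup>2 + 4 * d\<^sup>2 = Q" using ab(1) by (simp add: c_def d power2_eq_square)
  moreover have "{#- 1 - Q + 2 * P * a, - 1 + Q + 2 * P * b, - 1 - Q - 2 * P * a, - 1 + Q - 2 * P * b#}
    = {#Q + 4 * d * P - 1, Q - 4 * d * P - 1, - Q + 2 * c * P - 1, - Q - 2 * c * P - 1#}"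
    by (simp add: c_def d algebra_simps add_mset_commute)
  ultimately show ?thesis by blast
qed

text \<open>The sign of the quadratic Gauss sum \<open>g\<close> depends on the additive character; divisibility by 4
  forces the odd one of \<open>X\<close>, \<open>Y\<close> to accompany \<open>- \<surd>q\<close>, so that both signs give the same multiset.\<close>

lemma quartic_periods_1_mod_4:
  fixes g X Y A B :: int
  assumes p: "prime p" "odd p" and p4: "p mod 4 = 1" and t: "t > 0"
    and dvd: "\<forall>z\<in>{- 1 + g + 2 * X, - 1 - g + 2 * Y, - 1 + g - 2 * X, - 1 - g - 2 * Y}. 4 dvd z"
    and g: "g\<^sup>2 = int (p ^ (4 * t))" and XY: "X\<^sup>2 + Y\<^sup>2 = int (p ^ (4 * t))" "X\<^sup>2 - Y\<^sup>2 = g * A" "2 * X * Y = g * B"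
    and AB: "\<not> (int p dvd A \<and> int p dvd B)"
  shows "\<exists>c d. c\<^sup>2 + 4 * d\<^sup>2 = int p ^ (2 * t) \<and> [c = 1] (mod 4) \<and> coprime c (int p) \<and>
    {#- 1 + g + 2 * X, - 1 - g + 2 * Y, - 1 + g - 2 * X, - 1 - g - 2 * Y#}
    = {#int p ^ (2 * t) + 4 * d * int p ^ t - 1, int p ^ (2 * t) - 4 * d * int p ^ t - 1,
        - (int p ^ (2 * t)) + 2 * c * int p ^ t - 1, - (int p ^ (2 * t)) - 2 * c * int p ^ t - 1#}"
proof -
  define P Q where "P = int p ^ t" and "Q = int p ^ (2 * t)"
  have QP: "Q = P\<^sup>2" by (simp add: P_def Q_def mult.commute flip: power_mult)
  have Q2: "int (p ^ (4 * t)) = Q\<^sup>2" by (simp add: Q_def flip: power_mult)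
  have P0: "P \<noteq> 0" and oddP: "odd P" using p by (auto simp: P_def)
  have Q0: "Q \<noteq> 0" using P0 QP by simp
  have "[p ^ (2 * t) = 1 ^ (2 * t)] (mod 4)" by (rule cong_pow) (simp add: cong_def p4)
  then have "int (p ^ (2 * t) mod 4) = 1" by (simp add: cong_def)
  then have Q4: "Q mod 4 = 1" by (simp only: Q_def zmod_int of_nat_power of_nat_numeral)
  have gQ: "g = Q \<or> g = - Q" using g Q2 by (metis power2_eq_iff)
  then have "Q dvd X\<^sup>2 - Y\<^sup>2" unfolding XY by auto
  moreover have "X\<^sup>2 + Y\<^sup>2 = int p ^ (4 * t)" using XY by simp
  ultimately have "P dvd X" "P dvd Y"
    unfolding P_def Q_def using pow_dvd_components[OF p] by blast+
  then obtain a b where a: "X = P * a" and b: "Y = P * b" by (auto elim!: dvdE)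
  have sum: "a\<^sup>2 + b\<^sup>2 = Q"
  proof -
    have "Q * (a\<^sup>2 + b\<^sup>2) = Q * Q"
      using XY(1) unfolding Q2 a b QP by (simp add: power2_eq_square algebra_simps)
    then show ?thesis using Q0 by (metis mult_left_cancel)
  qed
  have pQ: "int p dvd Q" using t by (simp add: Q_def)
  have ip: "prime (int p)" using p by simp
  have AB': "g * A = Q * (a\<^sup>2 - b\<^sup>2)" "g * B = Q * (2 * a * b)"
    unfolding XY(2,3)[symmetric] a b QP by (simp_all add: power2_eq_square algebra_simps)
  \<comment> \<open>Up to sign, \<open>A + \<i> B\<close> is the square of
    \<open>a + \<i> b\<close>; so a common divisor \<open>p\<close> of \<open>a\<close> and
    \<open>b\<close> would also divide \<open>A\<close> and \<open>B\<close>.\<close>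
  have AB'': "A = a\<^sup>2 - b\<^sup>2 \<and> B = 2 * a * b \<or> - A = a\<^sup>2 - b\<^sup>2 \<and> - B = 2 * a * b"
    using gQ
  proof
    assume "g = - Q"
    then have "Q * (- A) = Q * (a\<^sup>2 - b\<^sup>2)" "Q * (- B) = Q * (2 * a * b)" using AB' by simp_all
    then show ?thesis using Q0 by (metis mult_left_cancel)
  qed (use AB' Q0 in auto)
  have not_both: "\<not> (int p dvd a \<and> int p dvd b)"
  proof
    assume "int p dvd a \<and> int p dvd b"
    then have "int p dvd a\<^sup>2 - b\<^sup>2" "int p dvd 2 * a * b" by (simp_all add: power2_eq_square)
    then show False using AB AB'' by (metis dvd_minus_iff)
  qed
  \<comment> \<open>As \<open>p\<close> divides \<open>a\<^sup>2 + b\<^sup>2\<close>, dividing one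
    of the two would mean dividing both.\<close>
  have na: "\<not> int p dvd a"
  proof
    assume *: "int p dvd a"
    then have "int p dvd a\<^sup>2" by (simp add: power2_eq_square)
    then have "int p dvd b\<^sup>2" using pQ sum by (metis dvd_add_right_iff)
    then show False using * not_both ip prime_dvd_power by blast
  qed
  have nb: "\<not> int p dvd b"
  proof
    assume *: "int p dvd b"
    then have "int p dvd b\<^sup>2" by (simp add: power2_eq_square)
    then have "int p dvd a\<^sup>2" using pQ sum by (metis dvd_add_left_iff)
    then show False using * not_both ip prime_dvd_power by blast
  qed
  have d4: "4 dvd - 1 + g + 2 * X" "4 dvd - 1 - g + 2 * Y" using dvd by simp_all
  from gQ show ?thesis
  proof
    assume gQ: "g = - Q"
    have "odd X" using d4(1) Q4 unfolding gQ by presburger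
    moreover have "even Y" using d4(2) Q4 unfolding gQ by presburger
    ultimately have "odd a" "even b" using oddP a b by simp_all
    from quartic_pair_from_parity[OF p(1) sum na this, of P] show ?thesis
      unfolding gQ a b P_def[symmetric] Q_def[symmetric] by (simp add: mult.assoc)
  next
    assume gQ: "g = Q"
    have "even X" using d4(1) Q4 unfolding gQ by presburger
    moreover have "odd Y" using d4(2) Q4 unfolding gQ by presburger
    ultimately have ev: "odd b" "even a" using oddP a b by simp_all
    have sum': "b\<^sup>2 + a\<^sup>2 = Q" using sum by simp
    have swap: "{#- 1 + Q + 2 * X, - 1 - Q + 2 * Y, - 1 + Q - 2 * X, - 1 - Q - 2 * Y#}
      = {#- 1 - Q + 2 * Y, - 1 + Q + 2 * X, - 1 - Q - 2 * Y, - 1 + Q - 2 * X#}"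
      by (simp add: add_mset_commute)
    from quartic_pair_from_parity[OF p(1) sum' nb ev, of P] show ?thesis
      unfolding gQ swap unfolding a b P_def[symmetric] Q_def[symmetric] by (simp add: mult.assoc)
  qed
qed

text \<open>One of \<open>X\<close> and \<open>Y\<close> is 0 and the other is \<open>Q\<close> or
  \<open>- Q\<close>. Divisibility by 4 ties the sign of \<open>g\<close> to which one vanishes, and
  in every case three of the four values coincide.\<close>

lemma quartic_periods_3_mod_4:
  fixes g X Y Q :: int
  assumes Q0: "Q \<noteq> 0" and g: "g\<^sup>2 = Q\<^sup>2" and XY: "X\<^sup>2 + Y\<^sup>2 = Q\<^sup>2" "X * Y = 0"
    and dvd: "\<forall>z\<in>{- 1 + g + 2 * X, - 1 - g + 2 * Y, - 1 + g - 2 * X, - 1 - g - 2 * Y}. 4 dvd z"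
  defines "M \<equiv> {#- 1 + g + 2 * X, - 1 - g + 2 * Y, - 1 + g - 2 * X, - 1 - g - 2 * Y#}"
  shows "Q mod 4 = 1 \<Longrightarrow> M = {#Q - 1, Q - 1, Q - 1, - 3 * Q - 1#}"
    and "Q mod 4 = 3 \<Longrightarrow> M = {#- Q - 1, - Q - 1, - Q - 1, 3 * Q - 1#}"
proof -
  have gQ: "g = Q \<or> g = - Q" using g by (simp add: power2_eq_iff)
  have XYQ: "Y = 0 \<and> (X = Q \<or> X = - Q) \<or> X = 0 \<and> (Y = Q \<or> Y = - Q)"
    using XY by (auto simp: power2_eq_iff)
  have d4: "4 dvd - 1 + g + 2 * X" "4 dvd - 1 - g + 2 * Y" using dvd by simp_all
  have four: "{#z1, z2, z3, z4#} = {#u, u, u, w#}"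
    if "z1 = w \<and> z2 = u \<and> z3 = u \<and> z4 = u \<or> z1 = u \<and> z2 = w \<and> z3 = u \<and> z4 = u
      \<or> z1 = u \<and> z2 = u \<and> z3 = w \<and> z4 = u \<or> z1 = u \<and> z2 = u \<and> z3 = u \<and> z4 = w"
    for z1 z2 z3 z4 u w :: int
    using that by (auto simp: add_mset_commute)
  show "M = {#Q - 1, Q - 1, Q - 1, - 3 * Q - 1#}" if "Q mod 4 = 1"
  proof -
    have "Y = 0 \<Longrightarrow> g = - Q" "X = 0 \<Longrightarrow> g = Q" using d4 gQ that by presburger+
    then have "g = - Q \<and> Y = 0 \<and> (X = Q \<or> X = - Q) \<or> g = Q \<and> X = 0 \<and> (Y = Q \<or> Y = - Q)"
      using XYQ by blast
    then show ?thesis unfolding M_def by (elim disjE conjE; intro four; simp)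
  qed
  show "M = {#- Q - 1, - Q - 1, - Q - 1, 3 * Q - 1#}" if "Q mod 4 = 3"
  proof -
    have "Y = 0 \<Longrightarrow> g = Q" "X = 0 \<Longrightarrow> g = - Q" using d4 gQ that by presburger+
    then have "g = Q \<and> Y = 0 \<and> (X = Q \<or> X = - Q) \<or> g = - Q \<and> X = 0 \<and> (Y = Q \<or> Y = - Q)"
      using XYQ by blast
    then show ?thesis unfolding M_def by (elim disjE conjE; intro four; simp)
  qed
qed

lemma geometric_sum_nat: "(p - 1) * (\<Sum>i<m. p ^ i) + 1 = p ^ m" if "p > 0" for p m :: nat
proof (induction m)
  case (Suc m)
  have "(p - 1) * (\<Sum>i<Suc m. p ^ i) + 1 = (p - 1) * p ^ m + ((p - 1) * (\<Sum>i<m. p ^ i) + 1)"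
    by (simp add: distrib_left)
  also have "\<dots> = p ^ Suc m" unfolding Suc using that by (simp add: diff_mult_distrib)
  finally show ?case .
qed simp

section \<open>Connectedness, integrality and the two residue classes of \<open>p\<close>\<close>

theorem theorem2p9:
  fixes p m q n :: nat and s r :: real and G :: "'a::{field,finite} pair_pre_digraph"
  assumes "prime p" and "odd p" and "q = p ^ m" and "q \<ge> 5" and "q \<noteq> 9"
    and "4 dvd (q - 1) div (p - 1)"
    and "n = (q - 1) div 4"
    and "CARD('a) = q"
    and "G = paley_sum_graph 4"
    and "s = sqrt (real q)" and "r = root 4 (real q)"
  shows "Digraph_Component.connected (with_proj G)
    \<and> (\<forall>x \<in># graph_spectrum G. x \<in> \<int>)
    \<and> ([p = 1] (mod 4) \<longrightarrow>
         (\<exists>t. m = 4 * t)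
       \<and> (\<exists>c d. quartic_pair p q c d)
       \<and> (\<forall>c d c' d'. quartic_pair p q c d \<and> quartic_pair p q c' d' \<longrightarrow>
             c' = c \<and> (d' = d \<or> d' = - d))
       \<and> (\<forall>c d. quartic_pair p q c d \<longrightarrow>
             graph_spectrum G = image_mset complex_of_real
               ({#real n#}
                + pm_mset (n div 2) ((s + 4 * of_int d * r - 1) / 4)
                + pm_mset (n div 2) ((s - 4 * of_int d * r - 1) / 4)
                + pm_mset (n div 2) ((- s + 2 * of_int c * r - 1) / 4)
                + pm_mset (n div 2) ((- s - 2 * of_int c * r - 1) / 4))))
    \<and> ([p = 3] (mod 4) \<longrightarrow>
         (\<exists>t. m = 2 * t)
       \<and> ([m = 0] (mod 4) \<longrightarrow>
             graph_spectrum G = image_mset complex_of_real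
               ({#real n#}
                + pm_mset (3 * n div 2) ((s - 1) / 4)
                + pm_mset (n div 2) ((3 * s + 1) / 4)))
       \<and> ([m = 2] (mod 4) \<longrightarrow>
             graph_spectrum G = image_mset complex_of_real
               ({#real n#}
                + pm_mset (3 * n div 2) ((s + 1) / 4)
                + pm_mset (n div 2) ((3 * s - 1) / 4))))"
proof -
  note p = \<open>prime p\<close> \<open>odd p\<close>
  \<comment> \<open>\<open>S\<close> is \<open>(q - 1) / (p - 1)\<close>. Its divisibility by 4
    gives \<open>n = (p - 1) * u\<close>, hence \<open>p - 1\<close> divides \<open>n\<close> and
    \<open>n\<close> is even.\<close>
  define S where "S = (\<Sum>i<m. p ^ i)"
  have p3: "p \<ge> 3" using p prime_ge_2_nat[of p] by (cases "p = 2") auto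
  have q_S: "q - 1 = (p - 1) * S" using geometric_sum_nat[of p m] p3 assms(3) by (simp add: S_def)
  then have "(q - 1) div (p - 1) = S" using p3 by simp
  then obtain u where u: "S = 4 * u" using assms(6) by (auto elim: dvdE)
  have qn: "q - 1 = 4 * ((p - 1) * u)" using q_S u by simp
  then have n: "n = (p - 1) * u" using assms(7) by simp
  then have card: "CARD('a) = 4 * n + 1" and q: "q = 4 * n + 1" using qn assms(4,8) by simp_all
  have card_p: "CARD('a) = p ^ m" using assms by simp
  have n_pos: "n > 0" and n_even: "even n" and dvd: "(p - 1) dvd n"
    using q assms(2,4) n by auto
  \<comment> \<open>The bound \<open>4 * n + 1 < (n + 1)\<^sup>2\<close> used for connectedness
    holds exactly when \<open>n > 2\<close>; the even value \<open>n = 2\<close> is the excluded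
    \<open>q = 9\<close>.\<close>
  have n_large: "n > 2"
  proof (rule ccontr)
    assume "\<not> n > 2"
    then have "n = 2" using n_even n_pos by presburger
    then show False using q assms(5) by simp
  qed
  obtain h :: 'a where "quartic_field h n"
    using quartic_field_exists[OF card n_pos n_even] by blast
  then interpret quartic_field h n .
  \<comment> \<open>Applied modulo 4 when \<open>p\<close> is 1 modulo 4, and modulo 2 otherwise,
    this turns divisibility of \<open>S\<close> into divisibility of \<open>m\<close>.\<close>
  have S_cong: "[S = m] (mod k)" if "[p = 1] (mod k)" for k
  proof -
    have "[S = (\<Sum>i<m. 1 ^ i)] (mod k)" unfolding S_def by (intro cong_sum cong_pow that)
    then show ?thesis by simp
  qed
  have "connected (with_proj G)"
    unfolding assms(9) paley_sum_graph_4
  proof (rule cayley_sum_graph_connected)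
    have "n * 2 < n * n" using n_large by simp
    then show "CARD('a) < (card {x::'a. x ^ n = 1} + 1)\<^sup>2"
      using card card_fibre[of 1] by (simp add: power2_eq_square)
  qed (use n_even card in \<open>auto simp: power_mult_distrib\<close>)
  moreover
  obtain g X Y A B :: int where
    spec: "graph_spectrum (paley_sum_graph 4 :: 'a pair_pre_digraph) = image_mset complex_of_real
      ({#real n#} + (\<Sum>z\<in>#{#- 1 + g + 2 * X, - 1 - g + 2 * Y, - 1 + g - 2 * X, - 1 - g - 2 * Y#}.
         pm_mset (n div 2) (of_int z / 4)))"
    and dvd4: "\<forall>z\<in>{- 1 + g + 2 * X, - 1 - g + 2 * Y, - 1 + g - 2 * X, - 1 - g - 2 * Y}. 4 dvd z"
    and g: "g\<^sup>2 = int (p ^ m)" and XY: "X\<^sup>2 + Y\<^sup>2 = int (p ^ m)" "X\<^sup>2 - Y\<^sup>2 = g * A" "2 * X * Y = g * B"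
    and AB: "p mod 4 = 3 \<longrightarrow> B = 0" "p mod 4 = 1 \<longrightarrow> \<not> (int p dvd A \<and> int p dvd B)"
    by (rule graph_spectrum_integers[OF p(1) card_p dvd]) (rule that; assumption)
  let ?M = "{#- 1 + g + 2 * X, - 1 - g + 2 * Y, - 1 + g - 2 * X, - 1 - g - 2 * Y#}"
  have spec: "graph_spectrum G = image_mset complex_of_real
      ({#real n#} + (\<Sum>z\<in>#M. pm_mset (n div 2) (of_int z / 4)))" if "?M = M" for M
    using spec unfolding assms(9) that .
  have "x \<in> \<int>" if x: "x \<in># graph_spectrum G" for x
  proof -
    have quarter: "complex_of_int z / 4 \<in> \<int>" if "4 dvd z" for z using that by (auto elim!: dvdE)
    have "x = of_nat n \<or> (\<exists>z\<in>#?M. x = of_int z / 4 \<or> x = - (of_int z / 4))"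
      using x unfolding spec[OF refl] by (auto simp: pm_mset_def split: if_splits)
    then show ?thesis
    proof
      assume "\<exists>z\<in>#?M. x = of_int z / 4 \<or> x = - (of_int z / 4)"
      moreover have "\<forall>z\<in>#?M. 4 dvd z"
        using dvd4 by (simp only: set_mset_add_mset_insert set_mset_empty)
      ultimately obtain z where "4 dvd z" "x = of_int z / 4 \<or> x = - (of_int z / 4)" by blast
      then show ?thesis using quarter by auto
    qed simp
  qed
  moreover have "(\<exists>t. m = 4 * t) \<and> (\<exists>c d. quartic_pair p q c d)
       \<and> (\<forall>c d c' d'. quartic_pair p q c d \<and> quartic_pair p q c' d' \<longrightarrow> c' = c \<and> (d' = d \<or> d' = - d))
       \<and> (\<forall>c d. quartic_pair p q c d \<longrightarrow>
             graph_spectrum G = image_mset complex_of_real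
               ({#real n#}
                + pm_mset (n div 2) ((s + 4 * of_int d * r - 1) / 4)
                + pm_mset (n div 2) ((s - 4 * of_int d * r - 1) / 4)
                + pm_mset (n div 2) ((- s + 2 * of_int c * r - 1) / 4)
                + pm_mset (n div 2) ((- s - 2 * of_int c * r - 1) / 4)))"
    if p4: "[p = 1] (mod 4)"
  proof -
    have "4 dvd m" using S_cong[OF p4] u by (simp add: cong_def mod_eq_0_iff_dvd)
    then obtain t where t: "m = 4 * t" by (elim dvdE)
    have t0: "t > 0" using assms(3,4) t by (cases t) auto
    have pm: "p mod 4 = 1" using p4 by (simp add: cong_def)
    have "real q = (real p ^ t) ^ 4"
      by (simp add: assms(3) t mult.commute flip: power_mult)
    then have r: "r = real p ^ t" by (simp add: assms(11) real_root_power_cancel)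
    have "real q = (real p ^ (2 * t))\<^sup>2"
      by (simp add: assms(3) t mult.commute flip: power_mult)
    then have s: "s = real p ^ (2 * t)" unfolding assms(10) by (simp only: real_sqrt_abs) simp
    have pair: "quartic_pair p q c d \<longleftrightarrow> c\<^sup>2 + 4 * d\<^sup>2 = int p ^ (2 * t) \<and> [c = 1] (mod 4) \<and> coprime c (int p)" for c d
    proof -
      have "sqrt (real q) = of_int (c\<^sup>2 + 4 * d\<^sup>2) \<longleftrightarrow> real_of_int (int p ^ (2 * t)) = of_int (c\<^sup>2 + 4 * d\<^sup>2)"
        using s assms(10) by simp
      then show ?thesis unfolding quartic_pair_def of_int_eq_iff by metis
    qed
    have unique: "c' = c \<and> (d' = d \<or> d' = - d)" if "quartic_pair p q c d" "quartic_pair p q c' d'" for c d c' d'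
      using that t0 unfolding pair by (intro sum_two_squares_unique[OF p, where k = "2 * t"]) auto
    obtain c d where cd: "quartic_pair p q c d" and M: "?M =
      {#int p ^ (2 * t) + 4 * d * int p ^ t - 1, int p ^ (2 * t) - 4 * d * int p ^ t - 1,
        - (int p ^ (2 * t)) + 2 * c * int p ^ t - 1, - (int p ^ (2 * t)) - 2 * c * int p ^ t - 1#}"
      using quartic_periods_1_mod_4[OF p pm t0 dvd4 g[unfolded t] XY[unfolded t] AB(2)[rule_format, OF pm]]
      unfolding pair by blast
    have spec_cd: "graph_spectrum G = image_mset complex_of_real
               ({#real n#}
                + pm_mset (n div 2) ((s + 4 * of_int d * r - 1) / 4)
                + pm_mset (n div 2) ((s - 4 * of_int d * r - 1) / 4)
                + pm_mset (n div 2) ((- s + 2 * of_int c * r - 1) / 4)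
                + pm_mset (n div 2) ((- s - 2 * of_int c * r - 1) / 4))"
      unfolding spec[OF M] s r by (simp add: add_ac)
    have "graph_spectrum G = image_mset complex_of_real
               ({#real n#}
                + pm_mset (n div 2) ((s + 4 * of_int d' * r - 1) / 4)
                + pm_mset (n div 2) ((s - 4 * of_int d' * r - 1) / 4)
                + pm_mset (n div 2) ((- s + 2 * of_int c' * r - 1) / 4)
                + pm_mset (n div 2) ((- s - 2 * of_int c' * r - 1) / 4))"
      if "quartic_pair p q c' d'" for c' d'
    proof -
      \<comment> \<open>By uniqueness another pair can differ only in the sign of \<open>d\<close>,
        which exchanges two of the summands.\<close>
      have "c' = c" "d' = d \<or> d' = - d" using unique[OF cd that] by auto
      then show ?thesis unfolding spec_cd by (auto simp: add_ac)
    qed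
    then show ?thesis using t cd unique by blast
  qed
  moreover have "(\<exists>t. m = 2 * t)
       \<and> ([m = 0] (mod 4) \<longrightarrow>
             graph_spectrum G = image_mset complex_of_real
               ({#real n#} + pm_mset (3 * n div 2) ((s - 1) / 4) + pm_mset (n div 2) ((3 * s + 1) / 4)))
       \<and> ([m = 2] (mod 4) \<longrightarrow>
             graph_spectrum G = image_mset complex_of_real
               ({#real n#} + pm_mset (3 * n div 2) ((s + 1) / 4) + pm_mset (n div 2) ((3 * s - 1) / 4)))"
    if p4: "[p = 3] (mod 4)"
  proof -
    have pm: "p mod 4 = 3" using p4 by (simp add: cong_def)
    have "[p = 1] (mod 2)" using p(2) by (simp add: cong_def odd_iff_mod_2_eq_one)
    then have "2 dvd S \<longleftrightarrow> even m" by (intro cong_dvd_iff S_cong)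
    then have "even m" using u by simp
    then obtain t where t: "m = 2 * t" by (elim evenE)
    define Q where "Q = int p ^ t"
    have Q2: "int (p ^ m) = Q\<^sup>2" by (simp add: Q_def t mult.commute flip: power_mult)
    have Q0: "Q \<noteq> 0" using p3 by (simp add: Q_def)
    have "real q = (real p ^ t)\<^sup>2" by (simp add: assms(3) t mult.commute flip: power_mult)
    then have s: "s = of_int Q" by (simp add: assms(10) Q_def)
    have XY0: "X * Y = 0" using XY(3) AB(1)[rule_format, OF pm] by simp
    note shape = quartic_periods_3_mod_4[OF Q0 g[unfolded Q2] XY(1)[unfolded Q2] XY0 dvd4]
    have three: "pm_mset k x + pm_mset k x + pm_mset k x = pm_mset (3 * k) x" for k x
      by (rule multiset_eqI) (simp add: pm_mset_def)
    have n3: "3 * n div 2 = 3 * (n div 2)" using n_even by (elim evenE) simp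
    have "int (p mod 4) = 3" using pm by simp
    then have p_cong: "[int p = - 1] (mod 4)" by (simp add: cong_def zmod_int)
    \<comment> \<open>The parity of \<open>t\<close>, that is, \<open>m\<close> modulo 4, decides
      the residue of \<open>Q\<close> and thus which multiset of periods occurs.\<close>
    have Q_mod: "[Q = (- 1) ^ t] (mod 4)" unfolding Q_def by (rule cong_pow[OF p_cong])
    have "graph_spectrum G = image_mset complex_of_real
        ({#real n#} + pm_mset (3 * n div 2) ((s - 1) / 4) + pm_mset (n div 2) ((3 * s + 1) / 4))"
      if "[m = 0] (mod 4)"
    proof -
      have "even t" using that t by (simp add: cong_def) presburger
      then have "Q mod 4 = 1" using Q_mod by (simp add: cong_def)
      then have M: "?M = {#Q - 1, Q - 1, Q - 1, - 3 * Q - 1#}" by (rule shape)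
      \<comment> \<open>The exceptional period is negative; \<open>pm_mset\<close> is unchanged when
        its argument is negated.\<close>
      have "(of_int (- 3 * Q - 1) / 4 :: real) = - ((3 * s + 1) / 4)" by (simp add: s field_simps)
      then show ?thesis unfolding spec[OF M] n3 three[symmetric]
        by (simp only: pm_mset_uminus sum_mset.insert image_mset_add_mset sum_mset.empty image_mset_empty) (simp add: s add_ac)
    qed
    moreover have "graph_spectrum G = image_mset complex_of_real
        ({#real n#} + pm_mset (3 * n div 2) ((s + 1) / 4) + pm_mset (n div 2) ((3 * s - 1) / 4))"
      if "[m = 2] (mod 4)"
    proof -
      have "odd t" using that t by (simp add: cong_def) presburger
      then have "Q mod 4 = 3" using Q_mod by (simp add: cong_def)
      then have M: "?M = {#- Q - 1, - Q - 1, - Q - 1, 3 * Q - 1#}" by (rule shape)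
      have "(of_int (- Q - 1) / 4 :: real) = - ((s + 1) / 4)" by (simp add: s field_simps)
      then show ?thesis unfolding spec[OF M] n3 three[symmetric]
        by (simp only: pm_mset_uminus sum_mset.insert image_mset_add_mset sum_mset.empty image_mset_empty) (simp add: s add_ac)
    qed
    ultimately show ?thesis using t by blast
  qed
  ultimately show ?thesis by blast
qed

end
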